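(* Let $K\subset\mathbb{R}^2$ be a compact strictly convex set of constant width and area $F$ bounded by a curve $\Gamma=\partial K$ of class $\mathcal{C}^2$ and length $L$. Let $F_e$ be the area with multiplicities of the evolute of $\Gamma$. Then $$L^2-4\pi F\ \leq\ \frac49\pi|F_e|.$$ Equality holds if and only if $\Gamma$ is a circle or a curve parallel to a Steiner curve at distance $L/2\pi$.
   Context: Let $p(\varphi)=\sup\{\langle x,(\cos\varphi,\sin\varphi)\rangle : x\in K\}$ be the ($2\pi$-periodic) support function of $K$. "Strictly convex set bounded by a curve of class $\mathcal{C}^2$" means that $p$ is of class $\mathcal{C}^2$ and $p(\varphi)+p''(\varphi)>0$ for every $\varphi$. Constant width means that $p(\varphi)+p(\varphi+\pi)$ is constant. With $N(\varphi)=(\cos\varphi,\sin\varphi)$ the boundary is $\gamma(\varphi)=p(\varphi)N(\varphi)+p'(\varphi)N'(\varphi)$, with $L=\int_0^{2\pi}p\,d\varphi$ and $F=\frac12\int_0^{2\pi}(p^2-p'^2)\,d\varphi$. The evolute of $\Gamma$ is the envelope of its normal lines, $\tilde\gamma=\gamma-(p+p'')N$; it is the envelope of the lines $x\cos t+y\sin t=f(t)$ with $f(t)=p'(t-\pi/2)$. The area with multiplicities of the curve enveloped by a family $x\cos t+y\sin t=f(t)$, with $f$ $2\pi$-periodic, is $\frac12\int_0^{2\pi}(f^2-f'^2)\,dt$. Thus $F_e=\frac12\int_0^{2\pi}(p'^2-p''^2)\,d\varphi\le 0$. A $\mathcal{C}^2$ function $f$ is the generalized support function of the (possibly non-convex)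 curve enveloped by the lines $x\cos t+y\sin t=f(t)$. The parallel curve at distance $c$ has generalized support function $f+c$. A Steiner curve (deltoid) is the hypocycloid of three cusps; a curve parallel to a Steiner curve at distance $c$ is one with generalized support function $c+a\cos\varphi+b\sin\varphi+A\sin(3(\varphi-\varphi_0))$, where $A>0$ and $a,b,\varphi_0\in\mathbb{R}$. *)

theory Defs
  imports "HOL-Analysis.Analysis"
begin

definition unit_normal :: "real \<Rightarrow> real ^ 2" where
  "unit_normal \<phi> = vector [cos \<phi>, sin \<phi>]"

text \<open>The derivative of \<^const>\<open>unit_normal\<close>.\<close>

definition unit_tangent :: "real \<Rightarrow> real ^ 2" where
  "unit_tangent \<phi> = vector [- sin \<phi>, cos \<phi>]"

definition support_fun :: "(real ^ 2) set \<Rightarrow> real \<Rightarrow> real" where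
  "support_fun K \<phi> = (SUP x\<in>K. x \<bullet> unit_normal \<phi>)"

definition C2_fun :: "(real \<Rightarrow> real) \<Rightarrow> bool" where
  "C2_fun f \<longleftrightarrow> (\<forall>x. f differentiable (at x)) \<and> (\<forall>x. deriv f differentiable (at x))
     \<and> continuous_on UNIV (deriv (deriv f))"

text \<open>For a compact convex \<open>K\<close>: strict convexity together with a \<open>C\<^sup>2\<close> boundary is understood, as usual
  for support functions, as smoothness of the support function and positivity of the
  radius of curvature \<open>p + p''\<close>.\<close>

definition strictly_convex_C2 :: "(real ^ 2) set \<Rightarrow> bool" where
  "strictly_convex_C2 K \<longleftrightarrow> C2_fun (support_fun K)
     \<and> (\<forall>\<phi>. support_fun K \<phi> + deriv (deriv (support_fun K)) \<phi> > 0)"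

definition constant_width :: "(real ^ 2) set \<Rightarrow> bool" where
  "constant_width K \<longleftrightarrow> (\<exists>w. \<forall>\<phi>. support_fun K \<phi> + support_fun K (\<phi> + pi) = w)"

text \<open>The curve with generalized support function \<open>f\<close>: the envelope of the lines
  \<open>x cos t + y sin t = f t\<close>, i.e. the solution of \<open>X \<bullet> N t = f t\<close>, \<open>X \<bullet> N' t = f' t\<close>.\<close>

definition envelope :: "(real \<Rightarrow> real) \<Rightarrow> real \<Rightarrow> real ^ 2" where
  "envelope f t = f t *\<^sub>R unit_normal t + deriv f t *\<^sub>R unit_tangent t"

text \<open>Area with multiplicities (signed) of \<^term>\<open>envelope f\<close>, for \<open>f\<close> of period \<open>2\<pi>\<close>.\<close>

definition enveloped_area :: "(real \<Rightarrow> real) \<Rightarrow> real" where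
  "enveloped_area f = 1 / 2 * integral {0..2 * pi} (\<lambda>t. (f t)\<^sup>2 - (deriv f t)\<^sup>2)"

definition boundary_curve :: "(real ^ 2) set \<Rightarrow> real \<Rightarrow> real ^ 2" where
  "boundary_curve K = envelope (support_fun K)"

text \<open>Arc length of the boundary: the image of \<^term>\<open>boundary_curve K\<close> is the frontier of \<open>K\<close>
  (\<open>range_boundary_curve\<close> below), and by strict convexity it is traversed once over a period.\<close>

definition boundary_length :: "(real ^ 2) set \<Rightarrow> real" where
  "boundary_length K =
     integral {0..2 * pi} (\<lambda>\<phi>. norm (vector_derivative (boundary_curve K) (at \<phi>)))"

definition evolute :: "(real ^ 2) set \<Rightarrow> real \<Rightarrow> real ^ 2" where
  "evolute K \<phi> = boundary_curve K \<phi>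
     - (support_fun K \<phi> + deriv (deriv (support_fun K)) \<phi>) *\<^sub>R unit_normal \<phi>"

text \<open>The normal line at \<^term>\<open>boundary_curve K \<phi>\<close> is \<open>X \<bullet> N (\<phi> + \<pi>/2) = p' \<phi>\<close>; see
  \<open>evolute_eq_envelope\<close> below.\<close>

definition evolute_support :: "(real ^ 2) set \<Rightarrow> real \<Rightarrow> real" where
  "evolute_support K t = deriv (support_fun K) (t - pi / 2)"

definition is_circle :: "(real ^ 2) set \<Rightarrow> bool" where
  "is_circle \<Gamma> \<longleftrightarrow> (\<exists>c r. r > 0 \<and> \<Gamma> = sphere c r)"

text \<open>Generalized support functions of Steiner curves (deltoids, \<open>A > 0\<close>): \<open>(a, b)\<close> is the centre,
  \<open>\<phi>0\<close> the rotation, \<open>A\<close> the size.\<close>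

definition steiner_support :: "real \<Rightarrow> real \<Rightarrow> real \<Rightarrow> real \<Rightarrow> real \<Rightarrow> real" where
  "steiner_support a b A \<phi>0 \<phi> = a * cos \<phi> + b * sin \<phi> + A * sin (3 * (\<phi> - \<phi>0))"

definition parallel_to_steiner_curve :: "real \<Rightarrow> (real ^ 2) set \<Rightarrow> bool" where
  "parallel_to_steiner_curve d \<Gamma> \<longleftrightarrow>
     (\<exists>a b A \<phi>0. A > 0 \<and> \<Gamma> = range (envelope (\<lambda>\<phi>. steiner_support a b A \<phi>0 \<phi> + d)))"

lemma inner_unit_normal: "x \<bullet> unit_normal \<phi> = x $ 1 * cos \<phi> + x $ 2 * sin \<phi>"
  by (simp add: unit_normal_def inner_vec_def sum_2)

lemma inner_unit_tangent: "x \<bullet> unit_tangent \<phi> = - x $ 1 * sin \<phi> + x $ 2 * cos \<phi>"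
  by (simp add: unit_tangent_def inner_vec_def sum_2)

lemma evolute_eq_envelope: "evolute K \<phi> = envelope (evolute_support K) (\<phi> + pi / 2)"
proof -
  have ev: "evolute_support K = (\<lambda>t. deriv (support_fun K) (t - pi / 2))"
    by (simp add: fun_eq_iff evolute_support_def)
  have "deriv (evolute_support K) (\<phi> + pi / 2) = deriv (deriv (support_fun K)) \<phi>"
  proof -
    have "(evolute_support K has_field_derivative D) (at (\<phi> + pi / 2)) \<longleftrightarrow>
        (deriv (support_fun K) has_field_derivative D) (at \<phi>)" for D
      using DERIV_shift[of "evolute_support K" D \<phi> "pi / 2"] by (simp add: ev)
    then show ?thesis by (simp add: deriv_def)
  qed
  then show ?thesis
    by (simp add: evolute_def boundary_curve_def envelope_def evolute_support_def vec_eq_iff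
        forall_2 unit_normal_def unit_tangent_def sin_add cos_add algebra_simps)
qed

lemma range_boundary_curve:
  assumes K: "compact K" "convex K" "K \<noteq> {}"
    and diff: "\<And>\<phi>. support_fun K differentiable (at \<phi>)"
  shows "range (boundary_curve K) = frontier K"
proof -
  let ?p = "support_fun K"
  have bdd: "bdd_above ((\<lambda>x. x \<bullet> unit_normal \<phi>) ` K)" for \<phi>
    by (intro bounded_imp_bdd_above compact_imp_bounded compact_continuous_image K continuous_intros)
  have le: "x \<bullet> unit_normal \<phi> \<le> ?p \<phi>" if "x \<in> K" for x \<phi>
    unfolding support_fun_def by (rule cSUP_upper[OF that bdd])
  have touch: "x = boundary_curve K \<phi>" if x: "x \<in> K" and eq: "x \<bullet> unit_normal \<phi> = ?p \<phi>" for x \<phi>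
  proof -
    have "(?p has_field_derivative deriv ?p \<phi>) (at \<phi>)"
      using diff DERIV_deriv_iff_real_differentiable by blast
    moreover have "((\<lambda>\<psi>. x \<bullet> unit_normal \<psi>) has_field_derivative x \<bullet> unit_tangent \<phi>) (at \<phi>)"
      unfolding inner_unit_normal inner_unit_tangent by (auto intro!: derivative_eq_intros)
    ultimately have "((\<lambda>\<psi>. ?p \<psi> - x \<bullet> unit_normal \<psi>) has_field_derivative
        deriv ?p \<phi> - x \<bullet> unit_tangent \<phi>) (at \<phi>)"
      by (rule DERIV_diff)
    then have "deriv ?p \<phi> - x \<bullet> unit_tangent \<phi> = 0"
      by (rule DERIV_local_min[where d = 1]) (use le[OF x] eq in auto)
    then have d: "deriv ?p \<phi> = - x $ 1 * sin \<phi> + x $ 2 * cos \<phi>"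
      by (simp add: inner_unit_tangent)
    have e: "?p \<phi> = x $ 1 * cos \<phi> + x $ 2 * sin \<phi>"
      using eq by (simp add: inner_unit_normal)
    have cs: "(sin \<phi>)\<^sup>2 + (cos \<phi>)\<^sup>2 = 1"
      by simp
    have "x $ 1 = ?p \<phi> * cos \<phi> - deriv ?p \<phi> * sin \<phi>"
      unfolding d e using cs by algebra
    moreover have "x $ 2 = ?p \<phi> * sin \<phi> + deriv ?p \<phi> * cos \<phi>"
      unfolding d e using cs by algebra
    ultimately show ?thesis
      by (simp add: vec_eq_iff forall_2 boundary_curve_def envelope_def unit_normal_def
          unit_tangent_def)
  qed
  have "boundary_curve K \<phi> \<in> frontier K" for \<phi>
  proof -
    have "continuous_on K (\<lambda>x. x \<bullet> unit_normal \<phi>)"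
      by (intro continuous_intros)
    then obtain x where x: "x \<in> K" "\<And>y. y \<in> K \<Longrightarrow> y \<bullet> unit_normal \<phi> \<le> x \<bullet> unit_normal \<phi>"
      using continuous_attains_sup[of K "\<lambda>x. x \<bullet> unit_normal \<phi>"] K by blast
    have "?p \<phi> \<le> x \<bullet> unit_normal \<phi>"
      unfolding support_fun_def by (rule cSUP_least) (use K x in auto)
    then have eq: "x \<bullet> unit_normal \<phi> = ?p \<phi>"
      using le[OF x(1)] by (simp add: antisym)
    have "x \<notin> interior K"
    proof
      assume "x \<in> interior K"
      then obtain e where e: "e > 0" "cball x e \<subseteq> K"
        using mem_interior_cball by blast
      have n1: "norm (unit_normal \<phi>) = 1"
        by (simp add: norm_eq_sqrt_inner inner_unit_normal) (simp add: unit_normal_def flip: power2_eq_square)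
      then have "x + e *\<^sub>R unit_normal \<phi> \<in> K"
        using e by (intro subsetD[OF e(2)]) (simp add: dist_norm)
      then have "(x + e *\<^sub>R unit_normal \<phi>) \<bullet> unit_normal \<phi> \<le> x \<bullet> unit_normal \<phi>"
        using x(2) by blast
      then show False
        using e n1 by (simp add: inner_add_left dot_square_norm)
    qed
    with x(1) have "x \<in> frontier K"
      using closure_subset by (auto simp: frontier_def)
    then show ?thesis using touch[OF x(1) eq] by simp
  qed
  moreover have "x \<in> range (boundary_curve K)" if xf: "x \<in> frontier K" for x
  proof -
    have clo: "closed K" using K compact_imp_closed by blast
    have xK: "x \<in> K" and xi: "x \<notin> interior K"
      using xf clo by (auto simp: frontier_def)
    have "\<exists>a. a \<noteq> 0 \<and> (\<forall>y\<in>K. a \<bullet> y \<le> a \<bullet> x)"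
    proof (cases "interior K = {}")
      case True
      then obtain a b where "a \<noteq> 0" "K \<subseteq> {x. a \<bullet> x = b}"
        by (rule empty_interior_subset_hyperplane[OF K(2)])
      then have "a \<bullet> y = b" if "y \<in> K" for y using that by blast
      then show ?thesis using \<open>a \<noteq> 0\<close> xK by (intro exI[of _ a]) simp
    next
      case False
      then have "x \<notin> rel_interior K"
        using xi by (simp only: rel_interior_nonempty_interior not_False_eq_True)
      then obtain a where a: "a \<noteq> 0" "\<And>y. y \<in> closure K \<Longrightarrow> a \<bullet> x \<le> a \<bullet> y"
          "\<And>y. y \<in> rel_interior K \<Longrightarrow> a \<bullet> x < a \<bullet> y"
        using supporting_hyperplane_relative_frontier[OF K(2) subsetD[OF closure_subset xK]] by metis
      then show ?thesis
        using subsetD[OF closure_subset[of K]] by (intro exI[of _ "- a"]) simp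
    qed
    then obtain a where a: "a \<noteq> 0" "\<And>y. y \<in> K \<Longrightarrow> a \<bullet> y \<le> a \<bullet> x" by blast
    have na: "norm a > 0" using a by simp
    have "(a $ 1)\<^sup>2 + (a $ 2)\<^sup>2 = (norm a)\<^sup>2"
      unfolding power2_norm_eq_inner by (simp add: inner_vec_def sum_2 power2_eq_square)
    then have "(a $ 1 / norm a)\<^sup>2 + (a $ 2 / norm a)\<^sup>2 = 1"
      using na by (simp only: power_divide add_divide_distrib[symmetric]) simp
    then obtain \<phi> where \<phi>: "a $ 1 / norm a = cos \<phi>" "a $ 2 / norm a = sin \<phi>"
      by (rule sincos_total_2pi)
    have ai: "y \<bullet> unit_normal \<phi> = (a \<bullet> y) / norm a" for y
      unfolding inner_unit_normal \<phi>[symmetric]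
      by (simp add: inner_vec_def sum_2 add_divide_distrib mult.commute)
    have "?p \<phi> \<le> x \<bullet> unit_normal \<phi>"
      unfolding support_fun_def
    proof (rule cSUP_least)
      show "y \<bullet> unit_normal \<phi> \<le> x \<bullet> unit_normal \<phi>" if "y \<in> K" for y
        unfolding ai by (rule divide_right_mono[OF a(2)[OF that]]) simp
    qed (rule K)
    then have "x = boundary_curve K \<phi>"
      using le[OF xK] by (intro touch xK antisym)
    then show ?thesis by simp
  qed
  ultimately show ?thesis by blast
qed

end

theory Submission
  imports Defs
begin

text \<open>Write the support function as \<open>p = d + f\<close> with \<open>2 d\<close> the width; constant width means that \<open>f\<close> is
  antiperiodic, \<open>f (t + \<pi>) = - f t\<close>. The difference of the two sides of the inequality is \<open>4\<pi>/9\<close> times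
  \<open>Q f = \<integral> (f'' + f) (f'' + 9 f)\<close> over \<open>[0, \<pi>]\<close>. Passing to \<open>u = f + \<alpha> cos + \<beta> sin\<close> does not change \<open>Q\<close>, and \<open>\<alpha>\<close>, \<open>\<beta>\<close>
  can be chosen such that \<open>u\<close> vanishes at \<open>z\<close>, \<open>z + \<pi>/3\<close>, \<open>z + 2\<pi>/3\<close> for some \<open>z\<close>. Integration by parts gives
  \<open>Q u = \<integral> (u'' + 9 u)\<^sup>2 + 8 \<integral> (u'\<^sup>2 - 9 u\<^sup>2)\<close>, where the last integral is nonnegative by Wirtinger's
  inequality on the three intervals. In the case of equality \<open>u'' = - 9 u\<close>, so \<open>u\<close> is a third harmonic.\<close>

subsection \<open>Wirtinger inequalities\<close>

lemma integral_nonneg_eq_0D: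
  fixes F :: "real \<Rightarrow> real"
  assumes "continuous_on {a..b} F" "\<And>x. x \<in> {a..b} \<Longrightarrow> F x \<ge> 0" "integral {a..b} F = 0" "x \<in> {a..b}" "a < b"
  shows "F x = 0"
  using assms integral_eq_0_iff[of a b F] by auto

section \<open>Integrals of periodic and antiperiodic functions\<close>

lemma periodic_integral_shift:
  fixes F :: "real \<Rightarrow> real"
  assumes cont: "continuous_on UNIV F" and per: "\<And>x. F (x + T) = F x" and "T \<ge> 0"
  shows "integral {a..a + T} F = integral {0..T} F"
proof -
  \<comment> \<open>\<open>R\<close> is so large that both \<open>x\<close> and \<open>x + T\<close>
    lie strictly inside (-R, R) for every \<open>x\<close> in \<open>I\<close>. Hence
    \<open>G\<close> is a primitive there, and \<open>G (x + T) - G x\<close> has derivative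
    \<open>F (x + T) - F x = 0\<close>.\<close>
  define R where "R = \<bar>a\<bar> + T + 1"
  define G where "G x = integral {-R..x} F" for x
  have G: "(G has_real_derivative F x) (at x within S)" if "-R < x" "x < R" for x S
  proof -
    have "(G has_real_derivative F x) (at x within {-R..R})"
      unfolding G_def using that
      by (intro integral_has_real_derivative continuous_on_subset[OF cont]) auto
    then show ?thesis
      using that by (simp add: at_within_Icc_at has_field_derivative_at_within)
  qed
  define I where "I = {- \<bar>a\<bar>..\<bar>a\<bar>}"
  have "((\<lambda>x. G (x + T) - G x) has_real_derivative 0) (at x within I)" if "x \<in> I" for x
  proof -
    have "((\<lambda>x. G (x + T)) has_real_derivative F (x + T) * 1) (at x within I)"
      using that \<open>T \<ge> 0\<close>
      by (intro DERIV_chain'[where g = G and f = "\<lambda>x. x + T"] G) (auto simp: I_def R_def intro!: derivative_eq_intros)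
    moreover have "(G has_real_derivative F x) (at x within I)"
      by (rule G) (use that \<open>T \<ge> 0\<close> in \<open>auto simp: I_def R_def\<close>)
    ultimately show ?thesis
      using per DERIV_diff by fastforce
  qed
  then obtain c where c: "G (x + T) - G x = c" if "x \<in> I" for x
    using has_field_derivative_zero_constant[of I "\<lambda>x. G (x + T) - G x"] by (auto simp: I_def)
  have I: "a \<in> I" "0 \<in> I"
    using abs_ge_self[of a] abs_ge_minus_self[of a] by (auto simp: I_def)
  then have "G (a + T) - G a = G (0 + T) - G 0"
    using c by metis
  moreover have "integral {x..x + T} F = G (x + T) - G x" if "x \<in> I" for x
    using Henstock_Kurzweil_Integration.integral_combine[of "-R" x "x + T" F] that \<open>T \<ge> 0\<close>
    by (simp add: G_def I_def R_def integrable_continuous_interval continuous_on_subset[OF cont])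
  ultimately show ?thesis
    using I by force
qed

lemma periodic_integral_double:
  fixes F :: "real \<Rightarrow> real"
  assumes "continuous_on UNIV F" "\<And>x. F (x + T) = F x" "T \<ge> 0"
  shows "integral {0..2 * T} F = 2 * integral {0..T} F"
  using Henstock_Kurzweil_Integration.integral_combine[of 0 T "2 * T" F] periodic_integral_shift[OF assms, of T] assms(3)
  by (simp add: integrable_continuous_interval continuous_on_subset[OF assms(1)])

lemma antiperiodic_integral_eq_0:
  fixes F :: "real \<Rightarrow> real"
  assumes "continuous_on UNIV F" "\<And>x. F (x + T) = - F x" "T \<ge> 0"
  shows "integral {0..2 * T} F = 0"
  using Henstock_Kurzweil_Integration.integral_combine[of 0 T "2 * T" F] integral_shift_real_ivl[of T T "2 * T" F] assms(2,3)
  by (simp add: integrable_continuous_interval continuous_on_subset[OF assms(1)])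

text \<open>With \<open>\<theta> = k (x - (a + b)/2)\<close> one has \<open>u'\<^sup>2 - k\<^sup>2 u\<^sup>2 = (u' + k u tan \<theta>)\<^sup>2 - (k u\<^sup>2 tan \<theta>)'\<close>; the strict bound on \<open>k\<close>
  keeps \<open>tan\<close> smooth up to the endpoints.\<close>

lemma wirtinger_dirichlet_less:
  fixes u u' :: "real \<Rightarrow> real"
  assumes der: "\<And>x. x \<in> {a..b} \<Longrightarrow> (u has_real_derivative u' x) (at x)"
    and cont: "continuous_on {a..b} u'" and "a \<le> b" and u0: "u a = 0" "u b = 0"
    and k: "k \<ge> 0" "k * (b - a) < pi"
  shows "k\<^sup>2 * integral {a..b} (\<lambda>x. (u x)\<^sup>2) \<le> integral {a..b} (\<lambda>x. (u' x)\<^sup>2)"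
proof -
  define m where "m = (a + b) / 2"
  define \<theta> where "\<theta> x = k * (x - m)" for x
  define v where "v x = u' x + k * u x * tan (\<theta> x)" for x
  have c0: "cos (\<theta> x) \<noteq> 0" if "x \<in> {a..b}" for x
  proof -
    have "\<bar>x - m\<bar> \<le> (b - a) / 2"
      using that by (auto simp: m_def field_simps)
    then have "\<bar>\<theta> x\<bar> \<le> k * ((b - a) / 2)"
      unfolding \<theta>_def abs_mult abs_of_nonneg[OF k(1)] by (intro mult_left_mono k)
    then have "\<bar>\<theta> x\<bar> < pi / 2"
      using k by simp
    then show ?thesis
      using cos_gt_zero_pi[of "\<theta> x"] by linarith
  qed
  have cu: "continuous_on {a..b} u"
    using der by (meson DERIV_isCont continuous_at_imp_continuous_on)
  have cv: "continuous_on {a..b} (\<lambda>x. (v x)\<^sup>2)"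
    unfolding v_def \<theta>_def by (intro continuous_intros cont cu) (use c0 \<theta>_def in auto)
  have "((\<lambda>x. (v x)\<^sup>2 - (u' x)\<^sup>2 + k\<^sup>2 * (u x)\<^sup>2) has_integral
      k * (u b)\<^sup>2 * tan (\<theta> b) - k * (u a)\<^sup>2 * tan (\<theta> a)) {a..b}"
  proof (rule fundamental_theorem_of_calculus[OF \<open>a \<le> b\<close>])
    fix x assume x: "x \<in> {a..b}"
    have "((\<lambda>x. k * (u x)\<^sup>2 * tan (\<theta> x)) has_real_derivative
        k * (2 * u x * u' x) * tan (\<theta> x) + k * (u x)\<^sup>2 * (k * inverse ((cos (\<theta> x))\<^sup>2))) (at x)"
      unfolding \<theta>_def using c0[OF x] by (auto intro!: derivative_eq_intros der[OF x] simp: \<theta>_def)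
    moreover have "inverse ((cos (\<theta> x))\<^sup>2) = 1 + (tan (\<theta> x))\<^sup>2"
      using tan_sec[of "\<theta> x"] c0[OF x] by (simp add: power_inverse)
    ultimately have "((\<lambda>x. k * (u x)\<^sup>2 * tan (\<theta> x)) has_real_derivative
        (v x)\<^sup>2 - (u' x)\<^sup>2 + k\<^sup>2 * (u x)\<^sup>2) (at x)"
      by (simp add: v_def power2_eq_square algebra_simps)
    then show "((\<lambda>x. k * (u x)\<^sup>2 * tan (\<theta> x)) has_vector_derivative
        (v x)\<^sup>2 - (u' x)\<^sup>2 + k\<^sup>2 * (u x)\<^sup>2) (at x within {a..b})"
      by (simp add: has_real_derivative_iff_has_vector_derivative has_vector_derivative_at_within)
  qed
  then have "integral {a..b} (\<lambda>x. (v x)\<^sup>2 - (u' x)\<^sup>2 + k\<^sup>2 * (u x)\<^sup>2) = 0"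
    using u0 by (simp add: integral_unique)
  moreover have "integral {a..b} (\<lambda>x. (v x)\<^sup>2 - (u' x)\<^sup>2 + k\<^sup>2 * (u x)\<^sup>2) =
      integral {a..b} (\<lambda>x. (v x)\<^sup>2) - integral {a..b} (\<lambda>x. (u' x)\<^sup>2) + k\<^sup>2 * integral {a..b} (\<lambda>x. (u x)\<^sup>2)"
    by (subst integral_add integral_diff integral_mult_right;
        (intro integrable_continuous_interval continuous_intros cv cont cu)?)+ simp
  moreover have "integral {a..b} (\<lambda>x. (v x)\<^sup>2) \<ge> 0"
    by (intro integral_nonneg integrable_continuous_interval cv) auto
  ultimately show ?thesis by simp
qed

text \<open>At the sharp constant the tangent would blow up at both endpoints, so the constant is
  reached as the limit of admissible \<open>k\<close> from the left.\<close>

lemma wirtinger_dirichlet: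
  fixes u u' :: "real \<Rightarrow> real"
  assumes der: "\<And>x. x \<in> {a..b} \<Longrightarrow> (u has_real_derivative u' x) (at x)"
    and cont: "continuous_on {a..b} u'" and "a < b" and u0: "u a = 0" "u b = 0"
  shows "(pi / (b - a))\<^sup>2 * integral {a..b} (\<lambda>x. (u x)\<^sup>2) \<le> integral {a..b} (\<lambda>x. (u' x)\<^sup>2)"
proof (rule tendsto_upperbound)
  show "((\<lambda>k. k\<^sup>2 * integral {a..b} (\<lambda>x. (u x)\<^sup>2)) \<longlongrightarrow>
      (pi / (b - a))\<^sup>2 * integral {a..b} (\<lambda>x. (u x)\<^sup>2)) (at_left (pi / (b - a)))"
    by (intro tendsto_intros)
  have "\<forall>\<^sub>F k in at_left (pi / (b - a)). 0 < k \<and> k < pi / (b - a)"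
    using eventually_at_left_real[of 0 "pi / (b - a)"] \<open>a < b\<close> by simp
  then show "\<forall>\<^sub>F k in at_left (pi / (b - a)).
      k\<^sup>2 * integral {a..b} (\<lambda>x. (u x)\<^sup>2) \<le> integral {a..b} (\<lambda>x. (u' x)\<^sup>2)"
  proof eventually_elim
    case (elim k)
    then show ?case
      using \<open>a < b\<close> by (intro wirtinger_dirichlet_less der cont u0) (auto simp: field_simps)
  qed
qed simp

text \<open>With a free coefficient one rule splits sums, differences and multiples alike. This
  explains the factors \<open>1 *\<close> and \<open>(- 1) *\<close> in integrands below.\<close>

lemma integral_add_scaled:
  fixes f g :: "real \<Rightarrow> real"
  assumes "continuous_on {a..b} f" "continuous_on {a..b} g"
  shows "integral {a..b} (\<lambda>x. f x + c * g x) = integral {a..b} f + c * integral {a..b} g"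
  using assms by (subst integral_add) (auto intro!: integrable_continuous_interval continuous_intros)

text \<open>Serves as integration by parts without boundary terms: in the applications
  \<open>G\<close> takes equal values at both ends by periodicity.\<close>

lemma integral_derivative_eq_0:
  fixes G g :: "real \<Rightarrow> real"
  assumes "\<And>x. (G has_real_derivative g x) (at x)" "G b = G a" "a \<le> b"
  shows "integral {a..b} g = 0"
  using fundamental_theorem_of_calculus[OF \<open>a \<le> b\<close>, of G g] assms
  by (simp add: has_real_derivative_iff_has_vector_derivative has_vector_derivative_at_within integral_unique)

lemma antiperiodic_derivative:
  fixes f f' :: "real \<Rightarrow> real"
  assumes der: "\<And>x. (f has_real_derivative f' x) (at x)" and anti: "\<And>x. f (x + T) = - f x"
  shows "f' (x + T) = - f' x"
proof -
  have "((\<lambda>x. - f (x + T)) has_real_derivative - f' (x + T)) (at x)"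
    using der[of "x + T"] by (intro DERIV_minus) (simp add: DERIV_shift)
  then have "(f has_real_derivative - f' (x + T)) (at x)"
    by (simp add: anti)
  then show ?thesis
    using DERIV_unique[OF der[of x]] by simp
qed

lemma antiperiodic_has_zero:
  fixes f :: "real \<Rightarrow> real"
  assumes cont: "continuous_on UNIV f" and anti: "\<And>x. f (x + T) = - f x" and "T \<ge> 0"
  obtains x where "f x = 0"
proof (cases "f 0 \<ge> 0")
  case True
  then have "\<exists>x\<ge>0. x \<le> T \<and> f x = 0"
    using anti[of 0] \<open>T \<ge> 0\<close> by (intro IVT2' continuous_on_subset[OF cont]) auto
  then show ?thesis using that by blast
next
  case False
  then have "\<exists>x\<ge>0. x \<le> T \<and> f x = 0"
    using anti[of 0] \<open>T \<ge> 0\<close> by (intro IVT' continuous_on_subset[OF cont]) auto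
  then show ?thesis using that by blast
qed

text \<open>A zero \<open>z\<close> exists by antiperiodicity and forces a zero at
  \<open>z + pi\<close>, so the Dirichlet inequality applies with constant 1. For the derivative of
  the support function this gives the sign of the evolute area.\<close>

lemma wirtinger_antiperiodic:
  fixes f f' :: "real \<Rightarrow> real"
  assumes der: "\<And>x. (f has_real_derivative f' x) (at x)" and cont: "continuous_on UNIV f'"
    and anti: "\<And>x. f (x + pi) = - f x"
  shows "integral {a..a + pi} (\<lambda>x. (f x)\<^sup>2) \<le> integral {a..a + pi} (\<lambda>x. (f' x)\<^sup>2)"
proof -
  have cf: "continuous_on UNIV f"
    using der by (meson DERIV_isCont continuous_at_imp_continuous_on)
  obtain z where z: "f z = 0"
    using antiperiodic_has_zero[OF cf anti] by auto
  note anti' = antiperiodic_derivative[OF der anti]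
  have "integral {z..z + pi} (\<lambda>x. (f x)\<^sup>2) \<le> integral {z..z + pi} (\<lambda>x. (f' x)\<^sup>2)"
    using wirtinger_dirichlet[of z "z + pi" f f'] der continuous_on_subset[OF cont] z anti[of z] by simp
  moreover have "integral {z..z + pi} (\<lambda>x. (f x)\<^sup>2) = integral {a..a + pi} (\<lambda>x. (f x)\<^sup>2)"
    using periodic_integral_shift[of "\<lambda>x. (f x)\<^sup>2" pi] anti cf by (simp add: continuous_intros)
  moreover have "integral {z..z + pi} (\<lambda>x. (f' x)\<^sup>2) = integral {a..a + pi} (\<lambda>x. (f' x)\<^sup>2)"
    using periodic_integral_shift[of "\<lambda>x. (f' x)\<^sup>2" pi] anti' cont by (simp add: continuous_intros)
  ultimately show ?thesis by simp
qed

text \<open>On each of the three intervals of length pi/3 the Dirichlet constant is (pi / (pi/3))^2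
  = 9.\<close>

lemma wirtinger_three_zeros:
  fixes u u' :: "real \<Rightarrow> real"
  assumes der: "\<And>x. (u has_real_derivative u' x) (at x)" and cont: "continuous_on UNIV u'"
    and zeros: "u z = 0" "u (z + pi / 3) = 0" "u (z + 2 * pi / 3) = 0" "u (z + pi) = 0"
  shows "9 * integral {z..z + pi} (\<lambda>x. (u x)\<^sup>2) \<le> integral {z..z + pi} (\<lambda>x. (u' x)\<^sup>2)"
proof -
  have cu: "continuous_on UNIV u"
    using der by (meson DERIV_isCont continuous_at_imp_continuous_on)
  have split: "integral {z..z + pi} F = integral {z..z + pi / 3} F
      + integral {z + pi / 3..z + 2 * pi / 3} F + integral {z + 2 * pi / 3..z + pi} F"
    if "continuous_on UNIV F" for F :: "real \<Rightarrow> real"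
    using Henstock_Kurzweil_Integration.integral_combine[of z "z + pi / 3" "z + pi" F]
      Henstock_Kurzweil_Integration.integral_combine[of "z + pi / 3" "z + 2 * pi / 3" "z + pi" F]
    by (simp add: integrable_continuous_interval continuous_on_subset[OF that])
  have piece: "9 * integral {a..b} (\<lambda>x. (u x)\<^sup>2) \<le> integral {a..b} (\<lambda>x. (u' x)\<^sup>2)"
    if "u a = 0" "u b = 0" "b - a = pi / 3" for a b
    using wirtinger_dirichlet[of a b u u'] der continuous_on_subset[OF cont] that pi_gt_zero
    by (simp add: power2_eq_square)
  have "continuous_on UNIV (\<lambda>x. (u x)\<^sup>2)" "continuous_on UNIV (\<lambda>x. (u' x)\<^sup>2)"
    by (intro continuous_intros cu cont)+
  note split[OF this(1)] split[OF this(2)]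
  with piece[of z "z + pi / 3"] piece[of "z + pi / 3" "z + 2 * pi / 3"]
    piece[of "z + 2 * pi / 3" "z + pi"] zeros show ?thesis
    by simp
qed

text \<open>The alternating sum below kills \<open>cos\<close> and \<open>sin\<close>, so a correction which vanishes at two of the
  points \<open>z\<close>, \<open>z + \<pi>/3\<close>, \<open>z + 2\<pi>/3\<close> vanishes at the third as well.\<close>

lemma antiperiodic_correct_three_zeros:
  fixes f :: "real \<Rightarrow> real"
  assumes cont: "continuous_on UNIV f" and anti: "\<And>x. f (x + pi) = - f x"
  obtains z \<alpha> \<beta> where "\<And>x. x \<in> {z, z + pi / 3, z + 2 * pi / 3, z + pi} \<Longrightarrow> f x + (\<alpha> * cos x + \<beta> * sin x) = 0"
proof -
  define S where "S x = f x - f (x + pi / 3) + f (x + 2 * pi / 3)" for x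
  have "continuous_on UNIV S"
    unfolding S_def
    by (intro continuous_intros continuous_on_compose2[OF cont]) auto
  \<comment> \<open>After the shift the last term becomes \<open>f (x + pi) = - f x\<close>, so
    \<open>S\<close> changes sign already under pi/3 and therefore has a zero.\<close>
  moreover have "S (x + pi / 3) = - S x" for x
    using anti[of x] by (simp add: S_def add.assoc)
  ultimately obtain z where z: "S z = 0"
    using antiperiodic_has_zero[of S "pi / 3"] by auto
  \<comment> \<open>The coefficient \<open>- f z\<close> makes \<open>u z = 0\<close>;
    \<open>B\<close> is then the solution of \<open>u (z + pi / 3) = 0\<close>.\<close>
  define B where "B = (f z / 2 - f (z + pi / 3)) * 2 / sqrt 3"
  define u where "u x = f x + (- f z * cos (x - z) + B * sin (x - z))" for x
  have u0: "u z = 0"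
    by (simp add: u_def)
  have u1: "u (z + pi / 3) = 0"
    by (simp add: u_def B_def cos_60 sin_60 field_simps)
  have c2: "cos (2 * pi / 3) = - (1 / 2)" "sin (2 * pi / 3) = sqrt 3 / 2"
    using cos_pi_minus[of "pi / 3"] sin_pi_minus[of "pi / 3"] by (simp_all add: cos_60 sin_60 field_simps)
  have "u (z + 2 * pi / 3) = u z - u (z + pi / 3) + u (z + 2 * pi / 3)"
    using u0 u1 by simp
  also have "\<dots> = S z"
    by (simp add: u_def S_def cos_60 sin_60 c2)
  finally have u2: "u (z + 2 * pi / 3) = 0"
    using z by simp
  have u3: "u (z + pi) = 0"
    by (simp add: u_def anti)
  have "u x = f x + ((- f z * cos z - B * sin z) * cos x + (B * cos z - f z * sin z) * sin x)" for x
    by (simp add: u_def cos_diff sin_diff algebra_simps)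
  with u0 u1 u2 u3 show ?thesis
    by (intro that[of z "- f z * cos z - B * sin z" "B * cos z - f z * sin z"]) auto
qed

section \<open>The quadratic form \<open>Q\<close> on antiperiodic functions\<close>

locale antiperiodic_C2 =
  fixes f f' f'' :: "real \<Rightarrow> real"
  assumes der: "\<And>x. (f has_real_derivative f' x) (at x)"
    and der': "\<And>x. (f' has_real_derivative f'' x) (at x)"
    and cont'': "continuous_on UNIV f''"
    and anti: "\<And>x. f (x + pi) = - f x"
begin

lemma cont: "continuous_on S f" and cont': "continuous_on S f'" and cont''_on: "continuous_on S f''"
  using der der' continuous_on_subset[OF cont'']
  by (meson DERIV_isCont continuous_at_imp_continuous_on subset_UNIV)+

lemma anti': "f' (x + pi) = - f' x"
  by (rule antiperiodic_derivative[OF der anti])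

lemma anti'': "f'' (x + pi) = - f'' x"
  by (rule antiperiodic_derivative[OF der' anti'])

lemma integral_by_parts: "integral {a..a + pi} (\<lambda>x. f x * f'' x) = - integral {a..a + pi} (\<lambda>x. (f' x)\<^sup>2)"
proof -
  have "integral {a..a + pi} (\<lambda>x. f x * f'' x + 1 * (f' x)\<^sup>2) = 0"
    by (rule integral_derivative_eq_0[where G = "\<lambda>x. f x * f' x"])
      (auto intro!: derivative_eq_intros der der' simp: anti anti' power2_eq_square)
  then show ?thesis
    by (subst (asm) integral_add_scaled) (auto intro!: continuous_intros cont cont' cont''_on)
qed

text \<open>The Fourier multiplier of \<open>Q\<close> is \<open>(n\<^sup>2 - 1) (n\<^sup>2 - 9)\<close>, and antiperiodic functions have odd frequencies \<open>n\<close>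
  only. The base point \<open>a\<close> is irrelevant, see \<open>Q_shift\<close>.\<close>

definition Q :: "real \<Rightarrow> real" where
  "Q a = integral {a..a + pi} (\<lambda>x. (f'' x + f x) * (f'' x + 9 * f x))"

lemma Q_shift: "Q a = Q b"
  unfolding Q_def
  by (subst (1 2) periodic_integral_shift) (auto intro!: continuous_intros cont cont''_on simp: anti anti'' algebra_simps)

text \<open>Writing the first factor as \<open>(f'' + 9 f) - 8 f\<close> leaves the square and the
  terms \<open>- 8 f f'' - 72 f^2\<close>; the product \<open>f f''\<close> is integrated by
  parts.\<close>

lemma Q_eq_squares:
  "Q a = integral {a..a + pi} (\<lambda>x. (f'' x + 9 * f x)\<^sup>2)
     + 8 * (integral {a..a + pi} (\<lambda>x. (f' x)\<^sup>2) - 9 * integral {a..a + pi} (\<lambda>x. (f x)\<^sup>2))"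
proof -
  have "Q a = integral {a..a + pi} (\<lambda>x. ((f'' x + 9 * f x)\<^sup>2 + (- 8) * (f x * f'' x)) + (- 72) * (f x)\<^sup>2)"
    unfolding Q_def by (rule arg_cong[of _ _ "integral _"]) (auto simp: power2_eq_square algebra_simps)
  also have "\<dots> = integral {a..a + pi} (\<lambda>x. (f'' x + 9 * f x)\<^sup>2)
      + (- 8) * integral {a..a + pi} (\<lambda>x. f x * f'' x) + (- 72) * integral {a..a + pi} (\<lambda>x. (f x)\<^sup>2)"
    by (subst integral_add_scaled, (intro continuous_intros cont cont''_on)+)+ (rule refl)
  finally show ?thesis
    by (simp add: integral_by_parts)
qed

text \<open>The expanded form in which \<open>Q\<close> is matched with length, area and evolute
  area in \<open>isoperimetric_deficit\<close>.\<close>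

lemma Q_eq: "Q a = integral {a..a + pi} (\<lambda>x. (f'' x)\<^sup>2)
    - 10 * integral {a..a + pi} (\<lambda>x. (f' x)\<^sup>2) + 9 * integral {a..a + pi} (\<lambda>x. (f x)\<^sup>2)"
proof -
  have "Q a = integral {a..a + pi} (\<lambda>x. ((f'' x)\<^sup>2 + 10 * (f x * f'' x)) + 9 * (f x)\<^sup>2)"
    unfolding Q_def by (rule arg_cong[of _ _ "integral _"]) (auto simp: power2_eq_square algebra_simps)
  also have "\<dots> = integral {a..a + pi} (\<lambda>x. (f'' x)\<^sup>2)
      + 10 * integral {a..a + pi} (\<lambda>x. f x * f'' x) + 9 * integral {a..a + pi} (\<lambda>x. (f x)\<^sup>2)"
    by (subst integral_add_scaled, (intro continuous_intros cont cont''_on)+)+ (rule refl)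
  finally show ?thesis
    by (simp add: integral_by_parts)
qed

text \<open>The locale takes the derivatives as parameters, so the corrected function can be
  supplied with explicit formulas for them.\<close>

lemma add_first_harmonic:
  "antiperiodic_C2 (\<lambda>x. f x + (\<alpha> * cos x + \<beta> * sin x)) (\<lambda>x. f' x + (\<beta> * cos x - \<alpha> * sin x))
     (\<lambda>x. f'' x - (\<alpha> * cos x + \<beta> * sin x))"
  by unfold_locales (auto intro!: derivative_eq_intros continuous_intros der der' cont'' simp: anti)

text \<open>For \<open>h = \<alpha> cos + \<beta> sin\<close> one has \<open>h'' = - h\<close>, so
  the integrand is the derivative of the Wronskian \<open>f' h - f h'\<close>, which has period
  pi.\<close>

lemma integral_first_harmonic:
  "integral {a..a + pi} (\<lambda>x. (f'' x + f x) * (\<alpha> * cos x + \<beta> * sin x)) = 0"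
  by (rule integral_derivative_eq_0[where
        G = "\<lambda>x. f' x * (\<alpha> * cos x + \<beta> * sin x) - f x * (\<beta> * cos x - \<alpha> * sin x)"])
    (auto intro!: derivative_eq_intros der der' simp: anti anti', simp_all add: algebra_simps)

text \<open>A first harmonic \<open>h\<close> leaves the factor \<open>f'' + f\<close> unchanged and
  adds \<open>8 h\<close> to the factor \<open>f'' + 9 f\<close>; the resulting cross term
  integrates to zero.\<close>

lemma Q_add_first_harmonic:
  "antiperiodic_C2.Q (\<lambda>x. f x + (\<alpha> * cos x + \<beta> * sin x)) (\<lambda>x. f'' x - (\<alpha> * cos x + \<beta> * sin x)) a = Q a"
proof -
  interpret u: antiperiodic_C2 "\<lambda>x. f x + (\<alpha> * cos x + \<beta> * sin x)" "\<lambda>x. f' x + (\<beta> * cos x - \<alpha> * sin x)"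
    "\<lambda>x. f'' x - (\<alpha> * cos x + \<beta> * sin x)"
    by (rule add_first_harmonic)
  have "u.Q a = integral {a..a + pi} (\<lambda>x. (f'' x + f x) * (f'' x + 9 * f x)
      + 8 * ((f'' x + f x) * (\<alpha> * cos x + \<beta> * sin x)))"
    unfolding u.Q_def by (rule arg_cong[of _ _ "integral _"]) (auto simp: algebra_simps)
  also have "\<dots> = Q a + 8 * integral {a..a + pi} (\<lambda>x. (f'' x + f x) * (\<alpha> * cos x + \<beta> * sin x))"
    unfolding Q_def by (subst integral_add_scaled) (intro continuous_intros cont cont''_on refl)+
  finally show ?thesis
    by (simp add: integral_first_harmonic)
qed

lemma Q_nonneg: "Q a \<ge> 0"
  and Q_zeroD: "Q a = 0 \<Longrightarrow> \<exists>\<alpha> \<beta> A \<phi>. A \<ge> 0 \<and> (\<forall>x. f x = \<alpha> * cos x + \<beta> * sin x + A * sin (3 * (x - \<phi>)))"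
proof -
  obtain z \<alpha> \<beta> where z: "\<And>x. x \<in> {z, z + pi / 3, z + 2 * pi / 3, z + pi} \<Longrightarrow> f x + (\<alpha> * cos x + \<beta> * sin x) = 0"
    using antiperiodic_correct_three_zeros[OF cont anti] by metis
  define u where "u x = f x + (\<alpha> * cos x + \<beta> * sin x)" for x
  define u' where "u' x = f' x + (\<beta> * cos x - \<alpha> * sin x)" for x
  define u'' where "u'' x = f'' x - (\<alpha> * cos x + \<beta> * sin x)" for x
  interpret u: antiperiodic_C2 u u' u''
    unfolding u_def u'_def u''_def by (rule add_first_harmonic)
  have Qu: "Q a = u.Q z"
    using Q_add_first_harmonic[of \<alpha> \<beta> z] Q_shift[of a z] by (simp add: u_def[abs_def] u''_def[abs_def])
  have wirtinger: "9 * integral {z..z + pi} (\<lambda>x. (u x)\<^sup>2) \<le> integral {z..z + pi} (\<lambda>x. (u' x)\<^sup>2)"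
    by (intro wirtinger_three_zeros[OF u.der u.cont']) (simp_all only: u_def z insert_iff simp_thms)
  have c: "continuous_on S (\<lambda>x. (u'' x + 9 * u x)\<^sup>2)" for S
    by (intro continuous_intros u.cont u.cont''_on)
  have square: "integral {z..z + pi} (\<lambda>x. (u'' x + 9 * u x)\<^sup>2) \<ge> 0"
    by (intro integral_nonneg integrable_continuous_interval c) auto
  show "Q a \<ge> 0"
    using wirtinger square by (simp add: Qu u.Q_eq_squares)
  assume "Q a = 0"
  with wirtinger square have "integral {z..z + pi} (\<lambda>x. (u'' x + 9 * u x)\<^sup>2) = 0"
    by (simp add: Qu u.Q_eq_squares)
  \<comment> \<open>By periodicity the integral of the square vanishes over the half turn starting
    at any \<open>x\<close>, which gives the pointwise equation on the whole line and not only on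
    one interval.\<close>
  moreover have "integral {x..x + pi} (\<lambda>x. (u'' x + 9 * u x)\<^sup>2) = integral {z..z + pi} (\<lambda>x. (u'' x + 9 * u x)\<^sup>2)" for x
    by (subst (1 2) periodic_integral_shift) (simp_all add: c u.anti u.anti'', simp_all add: power2_eq_square algebra_simps)
  ultimately have "(u'' x + 9 * u x)\<^sup>2 = 0" for x
    by (intro integral_nonneg_eq_0D[where a = x and b = "x + pi", OF c]) auto
  then have ode: "u'' x = - 9 * u x" for x
    by (simp add: eq_neg_iff_add_eq_0)
  \<comment> \<open>\<open>B * sin (3 * (x - z))\<close> solves the same equation, vanishes at
    \<open>z\<close> like \<open>u\<close>, and has the slope of \<open>u\<close> there.\<close>
  define B where "B = u' z / 3"
  define v where "v x = u x - B * sin (3 * (x - z))" for x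
  define v' where "v' x = u' x - 3 * B * cos (3 * (x - z))" for x
  have v: "(v has_real_derivative v' x) (at x)" for x
    unfolding v_def v'_def by (auto intro!: derivative_eq_intros u.der)
  have v': "(v' has_real_derivative u'' x + 9 * B * sin (3 * (x - z))) (at x)" for x
    unfolding v'_def by (auto intro!: derivative_eq_intros u.der')
  \<comment> \<open>Uniqueness by conservation of energy: \<open>v\<close> also satisfies
    \<open>v'' = - 9 v\<close>, and its energy is zero at \<open>z\<close>.\<close>
  have "((\<lambda>x. (v' x)\<^sup>2 + 9 * (v x)\<^sup>2) has_real_derivative 0) (at x)" for x
    by (rule derivative_eq_intros v v' refl)+ (simp add: ode v_def algebra_simps)
  then have "(v' x)\<^sup>2 + 9 * (v x)\<^sup>2 = (v' z)\<^sup>2 + 9 * (v z)\<^sup>2" for x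
    using DERIV_isconst_all by blast
  moreover have "u z = 0"
    using z by (simp add: u_def)
  ultimately have "(v' x)\<^sup>2 + 9 * (v x)\<^sup>2 = 0" for x
    by (simp add: v_def v'_def B_def)
  then have "v x = 0" for x
    by (simp add: add_nonneg_eq_0_iff)
  then have u: "u x = B * sin (3 * (x - z))" for x
    by (simp add: v_def)
  show "\<exists>\<alpha> \<beta> A \<phi>. A \<ge> 0 \<and> (\<forall>x. f x = \<alpha> * cos x + \<beta> * sin x + A * sin (3 * (x - \<phi>)))"
  proof (cases "B \<ge> 0")
    case True
    then show ?thesis
      using u by (intro exI[of _ "- \<alpha>"] exI[of _ "- \<beta>"] exI[of _ B] exI[of _ z]) (simp add: u_def algebra_simps)
  next
    case False
    \<comment> \<open>A negative amplitude is made positive by rotating the third harmonic through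
      pi/3, half of its period.\<close>
    have "sin (3 * (x - (z + pi / 3))) = - sin (3 * (x - z))" for x
      using sin_minus_pi[of "3 * (x - z)"] by (simp add: algebra_simps)
    then show ?thesis
      using u False
      by (intro exI[of _ "- \<alpha>"] exI[of _ "- \<beta>"] exI[of _ "- B"] exI[of _ "z + pi / 3"]) (simp add: u_def algebra_simps)
  qed
qed

end

text \<open>Once the first harmonic is removed, the rest satisfies \<open>g'' + 9 g = 0\<close>, so
  the integrand of \<open>Q\<close> vanishes identically. No sign is imposed on \<open>A\<close>;
  the value 0 covers circles.\<close>

lemma Q_third_harmonic:
  assumes "antiperiodic_C2 f f' f''"
    and f: "\<And>x. f x = \<alpha> * cos x + \<beta> * sin x + A * sin (3 * (x - \<phi>))"
  shows "antiperiodic_C2.Q f f'' a = 0"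
proof -
  interpret antiperiodic_C2 f f' f'' by fact
  have f': "f' x = \<beta> * cos x - \<alpha> * sin x + 3 * A * cos (3 * (x - \<phi>))" for x
    by (rule DERIV_unique[OF der]) (auto intro!: derivative_eq_intros simp: f[abs_def])
  have f'': "f'' x = - \<alpha> * cos x - \<beta> * sin x - 9 * A * sin (3 * (x - \<phi>))" for x
    by (rule DERIV_unique[OF der']) (auto intro!: derivative_eq_intros simp: f'[abs_def])
  interpret u: antiperiodic_C2 "\<lambda>x. f x + (- \<alpha> * cos x + - \<beta> * sin x)"
    "\<lambda>x. f' x + (- \<beta> * cos x - - \<alpha> * sin x)" "\<lambda>x. f'' x - (- \<alpha> * cos x + - \<beta> * sin x)"
    by (rule add_first_harmonic)
  have "u.Q a = 0"
    unfolding u.Q_def by (simp add: f f'')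
  then show ?thesis
    using Q_add_first_harmonic[of "- \<alpha>" "- \<beta>" a] by simp
qed

subsection \<open>Length and area from the support function\<close>

text \<open>Both measures are the integral over \<open>S\<close> of the same absolute Jacobian. An
  image can thus be measured through a simpler map with equal Jacobian.\<close>

lemma measure_image_eq_of_det_eq:
  fixes f g :: "real^'n::{finite,wellorder} \<Rightarrow> real^'n::_"
  assumes S: "S \<in> sets lebesgue"
    and f: "\<And>x. x \<in> S \<Longrightarrow> (f has_derivative f' x) (at x)" "inj_on f S"
    and g: "\<And>x. x \<in> S \<Longrightarrow> (g has_derivative g' x) (at x)" "inj_on g S"
    and det: "\<And>x. x \<in> S \<Longrightarrow> \<bar>det (matrix (f' x))\<bar> = \<bar>det (matrix (g' x))\<bar>"
    and "g ` S \<in> lmeasurable"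
  shows "f ` S \<in> lmeasurable" "measure lebesgue (f ` S) = measure lebesgue (g ` S)"
proof -
  note f' = has_derivative_at_withinI[OF f(1), where s = S]
  note g' = has_derivative_at_withinI[OF g(1), where s = S]
  have "((\<lambda>x. \<bar>det (matrix (g' x))\<bar>) has_integral measure lebesgue (g ` S)) S"
    using has_measure_differentiable_image[OF S g' g(2)] \<open>g ` S \<in> lmeasurable\<close> by blast
  then have "((\<lambda>x. \<bar>det (matrix (f' x))\<bar>) has_integral measure lebesgue (g ` S)) S"
    by (rule has_integral_eq[rotated]) (simp add: det)
  then show "f ` S \<in> lmeasurable" "measure lebesgue (f ` S) = measure lebesgue (g ` S)"
    using has_measure_differentiable_image[OF S f' f(2)] by blast+
qed

lemma has_derivative_vector_2:
  fixes f g :: "'a::real_normed_vector \<Rightarrow> real"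
  assumes "(f has_derivative f') F" "(g has_derivative g') F"
  shows "((\<lambda>x. vector [f x, g x] :: real^2) has_derivative (\<lambda>h. vector [f' h, g' h])) F"
proof -
  have eq: "(vector [a, b] :: real^2) = a *\<^sub>R axis 1 1 + b *\<^sub>R axis 2 1" for a b
    by (simp add: vec_eq_iff forall_2 axis_def)
  show ?thesis
    unfolding eq using assms by (auto intro!: derivative_eq_intros)
qed

lemma unit_normal_tangent_periodic: "unit_normal (\<phi> + 2 * pi) = unit_normal \<phi>"
  "unit_tangent (\<phi> + 2 * pi) = unit_tangent \<phi>"
  by (simp_all add: unit_normal_def unit_tangent_def)

lemma unit_normal_tangent_orthonormal [simp]: "unit_normal \<phi> \<bullet> unit_normal \<phi> = 1" "unit_tangent \<phi> \<bullet> unit_tangent \<phi> = 1"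
    "unit_tangent \<phi> \<bullet> unit_normal \<phi> = 0" "unit_normal \<phi> \<bullet> unit_tangent \<phi> = 0"
  unfolding inner_unit_normal inner_unit_tangent
  by (simp_all add: unit_normal_def unit_tangent_def flip: power2_eq_square)

lemma DERIV_inner_unit_normal_tangent:
  "((\<lambda>t. x \<bullet> unit_normal t) has_real_derivative x \<bullet> unit_tangent t) (at t)"
  "((\<lambda>t. x \<bullet> unit_tangent t) has_real_derivative - (x \<bullet> unit_normal t)) (at t)"
  unfolding inner_unit_normal inner_unit_tangent by (auto intro!: derivative_eq_intros)

lemma has_vector_derivative_unit_normal_tangent:
  "(unit_normal has_vector_derivative unit_tangent t) (at t)"
  "(unit_tangent has_vector_derivative - unit_normal t) (at t)"
proof -
  have eq: "unit_normal = (\<lambda>t. cos t *\<^sub>R axis 1 1 + sin t *\<^sub>R axis 2 1)"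
    "unit_tangent = (\<lambda>t. - sin t *\<^sub>R axis 1 1 + cos t *\<^sub>R axis 2 1)"
    by (simp_all add: fun_eq_iff vec_eq_iff forall_2 axis_def unit_normal_def unit_tangent_def)
  show "(unit_normal has_vector_derivative unit_tangent t) (at t)"
    "(unit_tangent has_vector_derivative - unit_normal t) (at t)"
    unfolding eq by (auto intro!: derivative_eq_intros)
qed

lemma unit_normal_tangent_expansion:
  "(c \<bullet> unit_normal t) *\<^sub>R unit_normal t + (c \<bullet> unit_tangent t) *\<^sub>R unit_tangent t = c"
proof -
  have "(sin t)\<^sup>2 + (cos t)\<^sup>2 = 1" by simp
  then have "(x * cos t + y * sin t) * cos t + (- x * sin t + y * cos t) * - sin t = x"
    "(x * cos t + y * sin t) * sin t + (- x * sin t + y * cos t) * cos t = y" for x y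
    by algebra+
  then show ?thesis
    unfolding inner_unit_normal inner_unit_tangent
    by (simp add: vec_eq_iff forall_2 unit_normal_def unit_tangent_def)
qed

lemma norm_unit_normal [simp]: "norm (unit_normal t) = 1"
  by (simp add: norm_eq_sqrt_inner)

lemma range_circle:
  assumes "r > 0"
  shows "range (\<lambda>t. c + r *\<^sub>R unit_normal t) = sphere c r"
proof (intro equalityI subsetI)
  fix x assume x: "x \<in> sphere c r"
  let ?y = "(1 / r) *\<^sub>R (x - c)"
  have "norm ?y = 1"
    using x assms by (simp add: dist_norm norm_minus_commute)
  then have "?y \<bullet> ?y = 1"
    by (metis dot_square_norm one_power2)
  then have "(?y $ 1)\<^sup>2 + (?y $ 2)\<^sup>2 = 1"
    by (simp only: inner_vec_def sum_2 inner_real_def power2_eq_square)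
  then obtain t where t: "?y $ 1 = cos t" "?y $ 2 = sin t"
    by (rule sincos_total_2pi)
  have "unit_normal t = ?y"
    unfolding unit_normal_def t[symmetric] by (simp only: vec_eq_iff forall_2 vector_2)
  then have "x = c + r *\<^sub>R unit_normal t"
    using assms by simp
  then show "x \<in> range (\<lambda>t. c + r *\<^sub>R unit_normal t)" by blast
qed (use assms in \<open>auto simp: dist_norm\<close>)

lemma envelope_inner: "envelope f t \<bullet> unit_normal t = f t"
  by (simp add: envelope_def inner_add_left)

text \<open>The two normal components \<open>deriv f t\<close> cancel, so the velocity is tangential
  and \<open>f + f''\<close> is the signed radius of curvature.\<close>

lemma has_vector_derivative_envelope:
  assumes "(f has_real_derivative deriv f t) (at t)" "(deriv f has_real_derivative f'') (at t)"
  shows "(envelope f has_vector_derivative (f t + f'') *\<^sub>R unit_tangent t) (at t)"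
proof -
  have "(envelope f has_vector_derivative
      (f t *\<^sub>R unit_tangent t + deriv f t *\<^sub>R unit_normal t)
      + (deriv f t *\<^sub>R (- unit_normal t) + f'' *\<^sub>R unit_tangent t)) (at t)"
    unfolding envelope_def[abs_def]
    by (intro has_vector_derivative_add has_vector_derivative_scaleR has_vector_derivative_unit_normal_tangent assms)
  then show ?thesis
    by (simp add: algebra_simps)
qed

section \<open>Boundary, length and area of a C2 convex body\<close>

locale C2_convex_body =
  fixes K :: "(real^2) set"
  assumes compact: "compact K" and convex: "convex K" and nonempty: "K \<noteq> {}"
    and C2: "strictly_convex_C2 K"
begin

abbreviation "p \<equiv> support_fun K"
abbreviation "p' \<equiv> deriv p"
abbreviation "p'' \<equiv> deriv p'"
abbreviation "\<gamma> \<equiv> boundary_curve K"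

lemma der: "(p has_real_derivative p' t) (at t)"
  and der': "(p' has_real_derivative p'' t) (at t)"
  and cont'': "continuous_on S p''"
  and curvature_radius_pos: "p t + p'' t > 0"
  using C2 DERIV_deriv_iff_real_differentiable continuous_on_subset
  unfolding strictly_convex_C2_def C2_fun_def by blast+

lemma cont: "continuous_on S p" and cont': "continuous_on S p'"
  using der der' by (meson DERIV_isCont continuous_at_imp_continuous_on)+

lemma periodic: "p (t + 2 * pi) = p t"
  by (simp add: support_fun_def unit_normal_tangent_periodic)

lemma periodic': "p' (t + 2 * pi) = p' t"
proof -
  have "(p has_real_derivative p' (t + 2 * pi)) (at t)"
    using der[of "t + 2 * pi"] by (simp add: DERIV_shift periodic)
  then show ?thesis
    using DERIV_unique[OF der] by metis
qed

lemma boundary_curve_periodic: "\<gamma> (t + 2 * pi) = \<gamma> t"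
  by (simp add: boundary_curve_def envelope_def unit_normal_tangent_periodic periodic periodic')

lemma inner_le_support: "x \<in> K \<Longrightarrow> x \<bullet> unit_normal t \<le> p t"
  unfolding support_fun_def
  by (intro cSUP_upper bounded_imp_bdd_above compact_imp_bounded compact_continuous_image compact continuous_intros)

lemma range_boundary_curve: "range \<gamma> = frontier K"
  by (rule Defs.range_boundary_curve)
    (use compact convex nonempty der in \<open>auto simp: real_differentiable_def\<close>)

lemma boundary_curve_in: "\<gamma> t \<in> K"
  using range_boundary_curve compact compact_imp_closed frontier_subset_eq by blast

lemma boundary_curve_inner: "\<gamma> t \<bullet> unit_normal t = p t"
  by (simp add: boundary_curve_def envelope_inner)

lemma has_vector_derivative_boundary_curve:
  "(\<gamma> has_vector_derivative (p t + p'' t) *\<^sub>R unit_tangent t) (at t)"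
  unfolding boundary_curve_def by (rule has_vector_derivative_envelope der der')+

text \<open>Strict convexity by a Sturm-type argument: \<open>h = p - \<gamma> a \<bullet> N\<close>
  is nonnegative, so its zeros are double, while \<open>h'' + h = p + p'' > 0\<close> forbids two
  zeros at distance at most pi.\<close>

lemma boundary_curve_inner_less:
  assumes "a \<noteq> b" "\<bar>a - b\<bar> < 2 * pi"
  shows "\<gamma> a \<bullet> unit_normal b < p b"
proof (rule ccontr)
  define h where "h t = p t - \<gamma> a \<bullet> unit_normal t" for t
  define h' where "h' t = p' t - \<gamma> a \<bullet> unit_tangent t" for t
  have h: "(h has_real_derivative h' t) (at t)" for t
    unfolding h_def h'_def by (intro DERIV_diff der DERIV_inner_unit_normal_tangent)
  have h': "(h' has_real_derivative p'' t + \<gamma> a \<bullet> unit_normal t) (at t)" for t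
    unfolding h'_def using DERIV_diff[OF der' DERIV_inner_unit_normal_tangent(2)] by simp
  have h_nonneg: "h t \<ge> 0" for t
    using inner_le_support[OF boundary_curve_in] by (simp add: h_def)
  have h'_0: "h' t = 0" if "h t = 0" for t
    by (rule DERIV_local_min[OF h zero_less_one]) (simp add: that h_nonneg)
  have no_zeros: False if "h s = 0" "h t = 0" "s < t" "t \<le> s + pi" for s t
  proof -
    \<comment> \<open>The derivative of \<open>u\<close> is \<open>(h'' + h) * sin (x - s)\<close>,
      positive between \<open>s\<close> and \<open>t\<close>, yet \<open>u\<close> vanishes at both
      because \<open>h\<close> and \<open>h'\<close> do.\<close>
    define u where "u x = h' x * sin (x - s) - h x * cos (x - s)" for x
    have "(u has_real_derivative (p x + p'' x) * sin (x - s)) (at x)" for x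
      unfolding u_def by (rule derivative_eq_intros h h' refl)+ (simp add: h_def algebra_simps)
    then obtain x where x: "s < x" "x < t" "u t - u s = (t - s) * ((p x + p'' x) * sin (x - s))"
      using MVT2[of s t u "\<lambda>x. (p x + p'' x) * sin (x - s)"] \<open>s < t\<close> by auto
    have "u t - u s = 0"
      using that by (simp add: u_def h'_0)
    moreover have "sin (x - s) > 0"
      using x that by (intro sin_gt_zero) auto
    ultimately show False
      using x curvature_radius_pos[of x] by simp
  qed
  assume "\<not> \<gamma> a \<bullet> unit_normal b < p b"
  then have "h b = 0"
    using h_nonneg[of b] by (simp add: h_def)
  moreover have "h a = 0"
    by (simp add: h_def boundary_curve_inner)
  moreover have "h (t + 2 * pi) = h t" for t
    by (simp add: h_def periodic unit_normal_tangent_periodic)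
  \<comment> \<open>The gaps from one zero to the other around the circle add up to
    \<open>2 * pi\<close>, so one of them is at most pi.\<close>
  ultimately show False
    using no_zeros[of a b] no_zeros[of b a] no_zeros[of a "b + 2 * pi"] no_zeros[of b "a + 2 * pi"] assms
    by (cases a b rule: linorder_cases) force+
qed

text \<open>Cauchy's formula: the speed is \<open>p + p''\<close>, and \<open>p''\<close> integrates
  to zero over a period.\<close>

lemma boundary_length_eq: "boundary_length K = integral {0..2 * pi} p"
proof -
  have n: "norm (unit_tangent t) = 1" for t
    by (simp add: norm_eq_sqrt_inner)
  have "norm (vector_derivative \<gamma> (at t)) = p t + 1 * p'' t" for t
    unfolding vector_derivative_at[OF has_vector_derivative_boundary_curve]
    using curvature_radius_pos[of t] by (simp add: n)
  moreover have "integral {0..2 * pi} p'' = 0"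
    using periodic'[of 0] by (intro integral_derivative_eq_0[OF der']) simp_all
  ultimately show ?thesis
    unfolding boundary_length_def by (simp add: integral_add_scaled[OF cont cont'', where c = 1, simplified])
qed

text \<open>The ray from \<open>\<gamma> 0\<close> through \<open>x\<close> is prolonged beyond
  \<open>x\<close> until it meets the frontier at some \<open>\<gamma> t\<close>.\<close>

lemma boundary_curve_covers:
  assumes "x \<in> interior K" "x \<noteq> \<gamma> 0"
  obtains s t where "0 < s" "s < 1" "0 < t" "t < 2 * pi" "x = \<gamma> 0 + s *\<^sub>R (\<gamma> t - \<gamma> 0)"
proof -
  obtain d where d: "d > 0" "x + d *\<^sub>R (x - \<gamma> 0) \<in> frontier K"
    using ray_to_frontier[OF compact_imp_bounded[OF compact] assms(1), of "x - \<gamma> 0"] assms(2) by auto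
  then obtain t' where t': "x + d *\<^sub>R (x - \<gamma> 0) = \<gamma> t'"
    unfolding range_boundary_curve[symmetric] by blast
  \<comment> \<open>\<open>k\<close> counts full turns, which brings the parameter into [0, 2 pi);
    the value 0 is excluded later because \<open>\<gamma> t\<close> differs from
    \<open>\<gamma> 0\<close>.\<close>
  define k where "k = \<lfloor>t' / (2 * pi)\<rfloor>"
  define t where "t = t' - 2 * pi * of_int k"
  have "\<gamma> (t + 2 * pi * of_int i) = \<gamma> t" for i :: int
  proof (induction i rule: int_induct[where k = 0])
    case (step1 i)
    then show ?case
      using boundary_curve_periodic[of "t + 2 * pi * of_int i"] by (simp add: algebra_simps)
  next
    case (step2 i)
    then show ?case
      using boundary_curve_periodic[of "t + 2 * pi * of_int (i - 1)"] by (simp add: algebra_simps)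
  qed simp
  from this[of k] have t: "\<gamma> t' = \<gamma> t"
    by (simp add: t_def)
  have eq: "\<gamma> t - \<gamma> 0 = (1 + d) *\<^sub>R (x - \<gamma> 0)"
    using t' t by (simp add: algebra_simps)
  then have "\<gamma> t \<noteq> \<gamma> 0"
    using assms d by auto
  then have "t \<noteq> 0" by auto
  moreover have "of_int k \<le> t' / (2 * pi)" "t' / (2 * pi) < of_int k + 1"
    unfolding k_def by linarith+
  then have "0 \<le> t" "t < 2 * pi"
    by (simp_all add: t_def field_simps)
  moreover have "x = \<gamma> 0 + (1 / (1 + d)) *\<^sub>R (\<gamma> t - \<gamma> 0)"
    using d by (simp add: eq)
  ultimately show ?thesis
    using d by (intro that[of "1 / (1 + d)" t]) auto
qed

text \<open>Twice the rate at which the segment from \<open>\<gamma> 0\<close> to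
  \<open>\<gamma> t\<close> sweeps area: height of \<open>\<gamma> 0\<close> below the tangent line
  times speed.\<close>

definition fan_density :: "real \<Rightarrow> real" where
  "fan_density t = ((\<gamma> t - \<gamma> 0) \<bullet> unit_normal t) * (p t + p'' t)"

lemma fan_height_pos: "0 < t \<Longrightarrow> t < 2 * pi \<Longrightarrow> (\<gamma> t - \<gamma> 0) \<bullet> unit_normal t > 0"
  using boundary_curve_inner_less[of 0 t] by (simp add: inner_diff_left boundary_curve_inner)

lemma fan_density_pos: "0 < t \<Longrightarrow> t < 2 * pi \<Longrightarrow> fan_density t > 0"
  using fan_height_pos curvature_radius_pos by (simp add: fan_density_def)

lemma continuous_on_fan_density: "continuous_on S fan_density"
proof -
  have "fan_density t = (p t - \<gamma> 0 \<bullet> unit_normal t) * (p t + p'' t)" for t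
    by (simp add: fan_density_def inner_diff_left boundary_curve_inner)
  then show ?thesis
    unfolding inner_unit_normal by (auto intro!: continuous_intros cont cont'')
qed

text \<open>The apex drops out: \<open>\<gamma> 0 \<bullet> unit_normal t\<close> is a first
  harmonic and hence orthogonal to \<open>p + p''\<close> over a period.\<close>

lemma integral_fan_density: "integral {0..2 * pi} fan_density = integral {0..2 * pi} (\<lambda>t. p t * (p t + p'' t))"
proof -
  have "fan_density t = p t * (p t + p'' t) + (- 1) * ((\<gamma> 0 \<bullet> unit_normal t) * (p t + p'' t))" for t
    by (simp add: fan_density_def inner_diff_left boundary_curve_inner algebra_simps)
  then have "integral {0..2 * pi} fan_density = integral {0..2 * pi} (\<lambda>t. p t * (p t + p'' t))
      + (- 1) * integral {0..2 * pi} (\<lambda>t. (\<gamma> 0 \<bullet> unit_normal t) * (p t + p'' t))"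
    unfolding inner_unit_normal
    by (subst integral_add_scaled[symmetric]) (auto intro!: continuous_intros cont cont'' integral_cong)
  also have "integral {0..2 * pi} (\<lambda>t. (\<gamma> 0 \<bullet> unit_normal t) * (p t + p'' t)) = 0"
  proof (rule integral_derivative_eq_0)
    show "((\<lambda>t. (\<gamma> 0 \<bullet> unit_normal t) * p' t - (\<gamma> 0 \<bullet> unit_tangent t) * p t) has_real_derivative
        (\<gamma> 0 \<bullet> unit_normal t) * (p t + p'' t)) (at t)" for t
      by (rule derivative_eq_intros DERIV_inner_unit_normal_tangent der der' refl)+ (simp add: algebra_simps)
  qed (use periodic[of 0] periodic'[of 0] unit_normal_tangent_periodic[of 0] in auto)
  finally show ?thesis by simp
qed

text \<open>The polar-type parametrisation \<open>(s, t) \<mapsto> \<gamma> 0 + s (\<gamma> t - \<gamma> 0)\<close> of \<open>K\<close> has the same Jacobian as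
  \<open>(s, t) \<mapsto> (s\<^sup>2 / 2, W t)\<close> with \<open>W' = fan_density\<close>, whose image is a box; this replaces Fubini.\<close>

lemma measure_eq_integral:
  "measure lebesgue K = 1 / 2 * integral {0..2 * pi} (\<lambda>t. p t * (p t + p'' t))"
proof -
  \<comment> \<open>The rectangle is open because the edges s = 0, t = 0 and t = 2 pi all collapse
    to \<open>\<gamma> 0\<close>.\<close>
  define S :: "(real^2) set" where "S = box (vector [0, 0]) (vector [1, 2 * pi])"
  have S: "z \<in> S \<longleftrightarrow> 0 < z $ 1 \<and> z $ 1 < 1 \<and> 0 < z $ 2 \<and> z $ 2 < 2 * pi" for z
    by (auto simp: S_def mem_box_cart forall_2)
  define W where "W t = integral {0..t} fan_density" for t
  define g :: "real^2 \<Rightarrow> real^2" where "g z = \<gamma> 0 + (z $ 1) *\<^sub>R (\<gamma> (z $ 2) - \<gamma> 0)" for z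
  define G :: "real^2 \<Rightarrow> real^2" where "G z = vector [(z $ 1)\<^sup>2 / 2, W (z $ 2)]" for z
  define g' :: "real^2 \<Rightarrow> real^2 \<Rightarrow> real^2" where "g' z h = (z $ 1) *\<^sub>R (h $ 2 *\<^sub>R ((p (z $ 2) + p'' (z $ 2)) *\<^sub>R unit_tangent (z $ 2)))
      + (h $ 1) *\<^sub>R (\<gamma> (z $ 2) - \<gamma> 0)" for z h
  define G' :: "real^2 \<Rightarrow> real^2 \<Rightarrow> real^2" where "G' z h = vector [z $ 1 * h $ 1, h $ 2 * fan_density (z $ 2)]" for z h
  have nth: "((\<lambda>z::real^2. z $ i) has_derivative (\<lambda>h. h $ i)) F" for i F
    by (intro bounded_linear_imp_has_derivative bounded_linear_vec_nth)
  have W': "(W has_real_derivative fan_density t) (at t within {0..2 * pi})" if "t \<in> {0..2 * pi}" for t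
    unfolding W_def by (rule integral_has_real_derivative[OF continuous_on_fan_density that])
  have W: "(W has_real_derivative fan_density t) (at t)" if "0 < t" "t < 2 * pi" for t
    using W'[of t] that by (simp add: at_within_Icc_at)
  have contW: "continuous_on {0..2 * pi} W"
    by (rule DERIV_continuous_on[OF W'])
  have W_less: "W s < W t" if "0 \<le> s" "s < t" "t \<le> 2 * pi" for s t
  proof (rule DERIV_pos_imp_increasing_open[OF that(2)])
    show "\<exists>y. (W has_real_derivative y) (at x) \<and> y > 0" if "s < x" "x < t" for x
      using that \<open>0 \<le> s\<close> \<open>t \<le> 2 * pi\<close> by (intro exI[of _ "fan_density x"] conjI W fan_density_pos) auto
    show "continuous_on {s..t} W"
      by (rule continuous_on_subset[OF contW]) (use that in auto)
  qed
  have W0: "W 0 = 0"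
    by (simp add: W_def)
  have "(g has_derivative g' z) (at z)" for z
  proof -
    have "((\<lambda>z. \<gamma> (z $ 2)) has_derivative
        (\<lambda>h. h $ 2 *\<^sub>R ((p (z $ 2) + p'' (z $ 2)) *\<^sub>R unit_tangent (z $ 2)))) (at z)"
      by (rule has_derivative_compose[OF nth has_vector_derivative_boundary_curve[unfolded has_vector_derivative_def]])
    then have "((\<lambda>z. \<gamma> (z $ 2) - \<gamma> 0) has_derivative
        (\<lambda>h. h $ 2 *\<^sub>R ((p (z $ 2) + p'' (z $ 2)) *\<^sub>R unit_tangent (z $ 2)))) (at z)"
      by (auto intro!: derivative_eq_intros)
    from has_derivative_add[OF has_derivative_const has_derivative_scaleR[OF nth this]] show ?thesis
      unfolding g_def[abs_def] g'_def[abs_def] by simp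
  qed
  moreover have "inj_on g S"
  proof (rule inj_onI)
    \<comment> \<open>Pairing the common image with the normal at \<open>y $ 2\<close>, where
      \<open>y\<close> has the larger radial coordinate, puts \<open>\<gamma> (z $ 2)\<close> at
      least as far out as \<open>\<gamma> (y $ 2)\<close>, against strict convexity.\<close>
    have less: False if "z \<in> S" "y \<in> S" "g z = g y" "z $ 1 \<le> y $ 1" "z $ 2 \<noteq> y $ 2" for z y
    proof -
      let ?N = "unit_normal (y $ 2)"
      have "z $ 1 *\<^sub>R (\<gamma> (z $ 2) - \<gamma> 0) = y $ 1 *\<^sub>R (\<gamma> (y $ 2) - \<gamma> 0)"
        using that by (simp add: g_def)
      then have "z $ 1 * ((\<gamma> (z $ 2) - \<gamma> 0) \<bullet> ?N) = y $ 1 * ((\<gamma> (y $ 2) - \<gamma> 0) \<bullet> ?N)"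
        by (metis inner_scaleR_left)
      also have "\<dots> \<ge> z $ 1 * ((\<gamma> (y $ 2) - \<gamma> 0) \<bullet> ?N)"
        using that fan_height_pos[of "y $ 2"] by (intro mult_right_mono) (auto simp: S)
      finally have "(\<gamma> (y $ 2) - \<gamma> 0) \<bullet> ?N \<le> (\<gamma> (z $ 2) - \<gamma> 0) \<bullet> ?N"
        using that by (simp add: S)
      moreover have "\<gamma> (z $ 2) \<bullet> ?N < p (y $ 2)"
        using that by (intro boundary_curve_inner_less) (auto simp: S)
      ultimately show False
        by (simp add: inner_diff_left boundary_curve_inner)
    qed
    fix z y assume *: "z \<in> S" "y \<in> S" "g z = g y"
    then have 2: "z $ 2 = y $ 2"
      using less[of z y] less[of y z] by force
    have "\<gamma> (z $ 2) \<noteq> \<gamma> 0"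
      using fan_height_pos[of "z $ 2"] * by (force simp: S)
    then have "z $ 1 = y $ 1"
      using * 2 by (simp add: g_def)
    with 2 show "z = y"
      by (simp add: vec_eq_iff forall_2)
  qed
  moreover have "(G has_derivative G' z) (at z)" if "z \<in> S" for z
  proof -
    have "((\<lambda>z. W (z $ 2)) has_derivative (\<lambda>h. h $ 2 * fan_density (z $ 2))) (at z)"
      using has_derivative_compose[OF nth has_field_derivative_imp_has_derivative[OF W], of z] that
      by (simp add: S mult.commute)
    moreover have "((\<lambda>z. (z $ 1)\<^sup>2 / 2) has_derivative (\<lambda>h. z $ 1 * h $ 1)) (at z)"
      by (auto intro!: derivative_eq_intros nth)
    ultimately show ?thesis
      unfolding G_def G'_def by (intro has_derivative_vector_2)
  qed
  moreover have "inj_on G S"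
  proof (rule inj_onI)
    fix z y assume *: "z \<in> S" "y \<in> S" "G z = G y"
    then have "(z $ 1)\<^sup>2 = (y $ 1)\<^sup>2" "W (z $ 2) = W (y $ 2)"
      by (simp_all add: G_def vec_eq_iff forall_2)
    then have "z $ 1 = y $ 1" "z $ 2 = y $ 2"
      using * W_less[of "z $ 2" "y $ 2"] W_less[of "y $ 2" "z $ 2"]
      by (auto simp: S) (cases "z $ 2" "y $ 2" rule: linorder_cases; simp)
    then show "z = y"
      by (simp add: vec_eq_iff forall_2)
  qed
  \<comment> \<open>Both determinants are \<open>z $ 1 * fan_density (z $ 2)\<close>, since the
    determinant of a vector with \<open>unit_tangent\<close> is its component along
    \<open>unit_normal\<close>.\<close>
  moreover have "\<bar>det (matrix (g' z))\<bar> = \<bar>det (matrix (G' z))\<bar>" for z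
    by (simp add: det_2 matrix_def g'_def G'_def axis_def fan_density_def inner_unit_normal unit_tangent_def algebra_simps)
  moreover have G_image: "G ` S = box (vector [0, 0]) (vector [1 / 2, W (2 * pi)])"
  proof (intro set_eqI iffI)
    fix y assume "y \<in> G ` S"
    then obtain z where z: "z \<in> S" "y = G z" by blast
    have "(z $ 1)\<^sup>2 < 1\<^sup>2"
      using z by (intro power_strict_mono) (auto simp: S)
    then show "y \<in> box (vector [0, 0]) (vector [1 / 2, W (2 * pi)])"
      using z W_less[of 0 "z $ 2"] W_less[of "z $ 2" "2 * pi"] W0
      by (auto simp: S G_def mem_box_cart forall_2)
  next
    fix y :: "real^2" assume "y \<in> box (vector [0, 0]) (vector [1 / 2, W (2 * pi)])"
    then have y: "0 < y $ 1" "y $ 1 < 1 / 2" "0 < y $ 2" "y $ 2 < W (2 * pi)"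
      by (auto simp: mem_box_cart forall_2)
    obtain t where t: "0 \<le> t" "t \<le> 2 * pi" "W t = y $ 2"
      using IVT'[of W 0 "y $ 2" "2 * pi"] contW W0 y by auto
    have "t \<noteq> 0" "t \<noteq> 2 * pi"
      using t y W0 by auto
    moreover have "sqrt (2 * y $ 1) < 1"
      using y by simp
    ultimately have "vector [sqrt (2 * y $ 1), t] \<in> S"
      using t y by (simp add: S)
    moreover have "G (vector [sqrt (2 * y $ 1), t]) = y"
      using t y by (simp add: G_def vec_eq_iff forall_2)
    ultimately show "y \<in> G ` S" by (metis imageI)
  qed
  moreover have "S \<in> sets lebesgue"
    by (simp add: S_def)
  ultimately have gS: "g ` S \<in> lmeasurable"
    and "measure lebesgue (g ` S) = measure lebesgue (G ` S)"
    using measure_image_eq_of_det_eq[of S g g' G G'] by auto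
  moreover have "measure lebesgue (G ` S) = W (2 * pi) / 2"
  proof -
    have "measure lborel (box a b) = measure lborel (cbox a b)" for a b :: "real^2"
      by (simp add: measure_lborel_box_eq measure_lborel_cbox_eq)
    moreover have "cbox (vector [0, 0]) (vector [1 / 2, W (2 * pi)] :: real^2) \<noteq> {}"
      using W_less[of 0 "2 * pi"] W0 by (auto simp: interval_ne_empty_cart forall_2)
    ultimately show ?thesis
      unfolding G_image by (simp add: content_cbox_cart UNIV_2)
  qed
  moreover have "g ` S \<subseteq> K"
  proof (rule image_subsetI)
    fix z assume "z \<in> S"
    moreover have "g z = (1 - z $ 1) *\<^sub>R \<gamma> 0 + (z $ 1) *\<^sub>R \<gamma> (z $ 2)"
      by (simp add: g_def algebra_simps)
    ultimately show "g z \<in> K"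
      using convexD[OF convex boundary_curve_in boundary_curve_in] by (simp add: S)
  qed
  moreover have "interior K \<subseteq> g ` S"
  proof
    fix x assume x: "x \<in> interior K"
    have "\<gamma> 0 \<in> frontier K"
      using range_boundary_curve by blast
    then have "x \<noteq> \<gamma> 0"
      using x by (auto simp: frontier_def)
    with x obtain s t where "0 < s" "s < 1" "0 < t" "t < 2 * pi" "x = \<gamma> 0 + s *\<^sub>R (\<gamma> t - \<gamma> 0)"
      by (rule boundary_curve_covers)
    then have "vector [s, t] \<in> S" "g (vector [s, t]) = x"
      by (simp_all add: S g_def)
    then show "x \<in> g ` S" by (metis imageI)
  qed
  moreover have "measure lebesgue (interior K) = measure lebesgue K"
    by (intro measure_interior compact_imp_bounded compact negligible_convex_frontier convex)
  moreover have "K \<in> lmeasurable" "interior K \<in> lmeasurable"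
    using compact lmeasurable_compact lmeasurable_interior compact_imp_bounded by blast+
  ultimately have "measure lebesgue K = W (2 * pi) / 2"
    using measure_mono_fmeasurable[of "g ` S" K lebesgue] measure_mono_fmeasurable[of "interior K" "g ` S" lebesgue]
    by (simp add: fmeasurableD)
  then show ?thesis
    by (simp add: W_def integral_fan_density)
qed

end

subsection \<open>Bodies of constant width\<close>

context C2_convex_body begin

text \<open>One inequality is Cauchy-Schwarz for \<open>\<gamma> t\<close> on the sphere; the other
  holds because the extreme point of the sphere in the given direction belongs to
  \<open>K\<close>.\<close>

lemma support_eq_of_frontier_sphere:
  assumes "frontier K = sphere c r"
  shows "p t = c \<bullet> unit_normal t + r"
proof (rule antisym)
  have "\<gamma> t \<in> sphere c r"
    using range_boundary_curve assms by blast
  then have "(\<gamma> t - c) \<bullet> unit_normal t \<le> r"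
    using norm_cauchy_schwarz[of "\<gamma> t - c" "unit_normal t"] by (simp add: dist_norm norm_minus_commute)
  then show "p t \<le> c \<bullet> unit_normal t + r"
    by (simp add: inner_diff_left boundary_curve_inner)
  have "r \<ge> 0"
    using \<open>\<gamma> t \<in> sphere c r\<close> by auto
  then have "c + r *\<^sub>R unit_normal t \<in> frontier K"
    unfolding assms by (simp add: dist_norm)
  then have "c + r *\<^sub>R unit_normal t \<in> K"
    using compact compact_imp_closed frontier_subset_eq by blast
  from inner_le_support[OF this, of t] show "c \<bullet> unit_normal t + r \<le> p t"
    by (simp add: inner_add_left)
qed

end

section \<open>The deficit as a multiple of \<open>Q\<close>, and the case of equality\<close>

locale C2_constant_width = C2_convex_body +
  fixes d :: real
  assumes width: "support_fun K t + support_fun K (t + pi) = 2 * d"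
begin

sublocale osc: antiperiodic_C2 "\<lambda>t. p t - d" p' p''
proof
  show "p (t + pi) - d = - (p t - d)" for t
    using width[of t] by simp
qed (auto intro!: derivative_eq_intros der der' cont'')

abbreviation (input) "I0 \<equiv> integral {0..pi} (\<lambda>t. (p t - d)\<^sup>2)"
abbreviation (input) "I1 \<equiv> integral {0..pi} (\<lambda>t. (p' t)\<^sup>2)"
abbreviation (input) "I2 \<equiv> integral {0..pi} (\<lambda>t. (p'' t)\<^sup>2)"

text \<open>Barbier's theorem: the oscillation \<open>p - d\<close> has mean zero over a full
  turn.\<close>

lemma boundary_length_width: "boundary_length K = 2 * pi * d"
proof -
  have "integral {0..2 * pi} (\<lambda>t. (p t - d) + d * 1)
      = integral {0..2 * pi} (\<lambda>t. p t - d) + d * integral {0..2 * pi} (\<lambda>t. 1)"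
    by (intro integral_add_scaled osc.cont continuous_intros)
  also have "integral {0..2 * pi} (\<lambda>t. p t - d) = 0"
    by (rule antiperiodic_integral_eq_0[OF osc.cont osc.anti]) simp
  finally show ?thesis
    by (simp add: boundary_length_eq)
qed

text \<open>\<open>\<gamma> pi\<close> lies strictly below the supporting line with the opposite
  normal. The bound makes \<open>d\<close> a legitimate radius in the circle case.\<close>

lemma half_width_pos: "d > 0"
proof -
  have "\<gamma> pi \<bullet> unit_normal 0 < p 0"
    by (rule boundary_curve_inner_less) auto
  moreover have "\<gamma> pi \<bullet> unit_normal 0 = - p pi"
    using boundary_curve_inner[of pi] by (simp add: inner_unit_normal)
  ultimately show ?thesis
    using width[of 0] by simp
qed

text \<open>With \<open>p = d + f\<close>, terms linear in \<open>f\<close> or \<open>p''\<close>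
  are antiperiodic and integrate to zero, while the quadratic ones have period pi and count
  twice.\<close>

lemma measure_width: "measure lebesgue K = pi * d\<^sup>2 + I0 - I1"
proof -
  let ?f = "\<lambda>t. p t - d"
  note c = continuous_intros osc.cont cont cont''
  have "integral {0..2 * pi} (\<lambda>t. p t * (p t + p'' t))
      = integral {0..2 * pi} (\<lambda>t. (((?f t)\<^sup>2 + 1 * (?f t * p'' t)) + d * (2 * ?f t + p'' t)) + d\<^sup>2 * 1)"
    by (rule arg_cong[of _ _ "integral _"]) (auto simp: power2_eq_square algebra_simps)
  also have "\<dots> = integral {0..2 * pi} (\<lambda>t. (?f t)\<^sup>2 + 1 * (?f t * p'' t))
      + d * integral {0..2 * pi} (\<lambda>t. 2 * ?f t + p'' t) + d\<^sup>2 * integral {0..2 * pi} (\<lambda>t. 1)"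
    by (subst integral_add_scaled, (intro c)+)+ (rule refl)
  also have "integral {0..2 * pi} (\<lambda>t. 2 * ?f t + p'' t) = 0"
    by (rule antiperiodic_integral_eq_0) (auto intro!: c simp: osc.anti osc.anti'')
  also have "integral {0..2 * pi} (\<lambda>t. (?f t)\<^sup>2 + 1 * (?f t * p'' t))
      = 2 * integral {0..pi} (\<lambda>t. (?f t)\<^sup>2 + 1 * (?f t * p'' t))"
    by (rule periodic_integral_double) (auto intro!: c simp only: osc.anti osc.anti'' power2_minus minus_mult_minus pi_ge_zero)
  also have "\<dots> = 2 * (I0 + 1 * integral {0..pi} (\<lambda>t. ?f t * p'' t))"
    by (subst integral_add_scaled, (intro c)+) (rule refl)
  finally show ?thesis
    using osc.integral_by_parts[of 0] by (simp add: measure_eq_integral)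
qed

text \<open>The integrand has period pi, so the quarter-turn shift is immaterial and the two half
  turns cancel the factor 1/2.\<close>

lemma enveloped_area_evolute: "enveloped_area (evolute_support K) = I1 - I2"
proof -
  have "(evolute_support K has_real_derivative p'' (t - pi / 2)) (at t)" for t
    unfolding evolute_support_def[abs_def]
    using der'[of "t - pi / 2"] DERIV_shift[of "\<lambda>t. p' (t - pi / 2)" _ "t - pi / 2" "pi / 2"] by simp
  then have d: "deriv (evolute_support K) t = p'' (t - pi / 2)" for t
    by (rule DERIV_imp_deriv)
  let ?H = "\<lambda>t. (p' t)\<^sup>2 + (- 1) * (p'' t)\<^sup>2"
  have c: "continuous_on UNIV ?H"
    by (intro continuous_intros cont' cont'')
  have c2: "continuous_on UNIV (\<lambda>t. ?H (t - pi / 2))"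
    by (intro continuous_on_compose2[OF c] continuous_intros) auto
  have per: "?H (t + pi) = ?H t" for t
    by (simp add: osc.anti' osc.anti'')
  have per2: "?H (t + pi - pi / 2) = ?H (t - pi / 2)" for t
    using per[of "t - pi / 2"] by (simp add: algebra_simps)
  have "enveloped_area (evolute_support K) = 1 / 2 * integral {0..2 * pi} (\<lambda>t. ?H (t - pi / 2))"
    by (simp add: enveloped_area_def d evolute_support_def)
  also have "integral {0..2 * pi} (\<lambda>t. ?H (t - pi / 2)) = 2 * integral {0..pi} (\<lambda>t. ?H (t - pi / 2))"
    by (rule periodic_integral_double[OF c2 per2]) simp
  also have "integral {0..pi} (\<lambda>t. ?H (t - pi / 2)) = integral {- (pi / 2)..- (pi / 2) + pi} ?H"
    using integral_shift_real_ivl[of "- (pi / 2)" "- (pi / 2)" "pi / 2" ?H] by simp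
  also have "\<dots> = integral {0..pi} ?H"
    by (rule periodic_integral_shift[OF c per]) simp
  also have "\<dots> = I1 + (- 1) * I2"
    by (intro integral_add_scaled continuous_intros cont' cont'')
  finally show ?thesis by simp
qed

text \<open>The terms in \<open>d\<close> cancel, so \<open>L^2 - 4 pi F\<close> is
  \<open>4 pi (I1 - I0)\<close>; combined with \<open>I2 - I1\<close> this is the expansion
  \<open>Q_eq\<close>.\<close>

lemma isoperimetric_deficit:
  "4 / 9 * pi * \<bar>enveloped_area (evolute_support K)\<bar> - ((boundary_length K)\<^sup>2 - 4 * pi * measure lebesgue K)
     = 4 / 9 * pi * osc.Q 0"
proof -
  \<comment> \<open>Wirtinger for \<open>p'\<close> shows that the evolute area is nonpositive,
    which resolves the absolute value.\<close>
  have "I1 \<le> I2"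
    using wirtinger_antiperiodic[OF der' cont'' osc.anti', of 0] by simp
  then have abs: "\<bar>enveloped_area (evolute_support K)\<bar> = I2 - I1"
    by (simp add: enveloped_area_evolute)
  show ?thesis
    unfolding abs boundary_length_width measure_width osc.Q_eq by (simp add: power2_eq_square algebra_simps)
qed

text \<open>A zero of \<open>Q\<close> means that \<open>p - d\<close> is a first harmonic, which
  only moves the centre, plus a third harmonic of amplitude \<open>A\<close>: a circle for
  \<open>A = 0\<close>, a parallel of a deltoid for \<open>A > 0\<close>. Conversely,
  \<open>p\<close> has to be recovered from the frontier as a bare point set.\<close>

lemma Q_eq_0_iff:
  "osc.Q 0 = 0 \<longleftrightarrow> is_circle (frontier K) \<or> parallel_to_steiner_curve d (frontier K)"
proof
  assume "osc.Q 0 = 0"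
  then obtain \<alpha> \<beta> A \<phi> where A: "A \<ge> 0"
    and eq: "\<And>t. p t - d = \<alpha> * cos t + \<beta> * sin t + A * sin (3 * (t - \<phi>))"
    using osc.Q_zeroD by blast
  then have p: "p = (\<lambda>t. steiner_support \<alpha> \<beta> A \<phi> t + d)"
    by (simp add: fun_eq_iff steiner_support_def) (metis diff_add_cancel)
  show "is_circle (frontier K) \<or> parallel_to_steiner_curve d (frontier K)"
  proof (cases "A = 0")
    case True
    define c :: "real^2" where "c = vector [\<alpha>, \<beta>]"
    have p: "p t = c \<bullet> unit_normal t + d" for t
      using p True by (simp add: steiner_support_def c_def inner_unit_normal)
    have "(p has_real_derivative c \<bullet> unit_tangent t) (at t)" for t
      unfolding p[abs_def] by (auto intro!: derivative_eq_intros DERIV_inner_unit_normal_tangent)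
    then have p': "p' t = c \<bullet> unit_tangent t" for t
      by (rule DERIV_imp_deriv)
    have "\<gamma> t = c + d *\<^sub>R unit_normal t" for t
    proof -
      have "\<gamma> t = ((c \<bullet> unit_normal t) *\<^sub>R unit_normal t + (c \<bullet> unit_tangent t) *\<^sub>R unit_tangent t) + d *\<^sub>R unit_normal t"
        unfolding boundary_curve_def envelope_def p p' by (simp add: algebra_simps)
      then show ?thesis
        by (simp only: unit_normal_tangent_expansion)
    qed
    then have "frontier K = sphere c d"
      using range_circle[OF half_width_pos, of c] range_boundary_curve by (simp add: image_def)
    then show ?thesis
      using half_width_pos by (auto simp: is_circle_def)
  next
    case False
    then have "A > 0"
      using A by simp
    then show ?thesis
      using range_boundary_curve p unfolding boundary_curve_def parallel_to_steiner_curve_def by metis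
  qed
next
  assume "is_circle (frontier K) \<or> parallel_to_steiner_curve d (frontier K)"
  then show "osc.Q 0 = 0"
  proof
    assume "is_circle (frontier K)"
    then obtain c r where "frontier K = sphere c r"
      by (auto simp: is_circle_def)
    note p = support_eq_of_frontier_sphere[OF this]
    have "r = d"
      using width[of 0] p[of 0] p[of pi] by (simp add: inner_unit_normal)
    then show ?thesis
      using p by (intro Q_third_harmonic[where A = 0 and \<alpha> = "c $ 1" and \<beta> = "c $ 2", OF osc.antiperiodic_C2_axioms])
        (simp add: inner_unit_normal)
  next
    assume "parallel_to_steiner_curve d (frontier K)"
    \<comment> \<open>\<open>p\<close> dominates the generalized support function, and both have width \<open>2 d\<close>, so they agree;
      whether the deltoid's parallel curve is convex never matters.\<close>
    then obtain a b A \<phi>0 where range: "frontier K = range (envelope (\<lambda>\<phi>. steiner_support a b A \<phi>0 \<phi> + d))"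
      by (auto simp: parallel_to_steiner_curve_def)
    let ?s = "\<lambda>\<phi>. steiner_support a b A \<phi>0 \<phi> + d"
    have le: "?s t \<le> p t" for t
    proof -
      have "envelope ?s t \<in> K"
        using range compact compact_imp_closed frontier_subset_eq by blast
      then show ?thesis
        using inner_le_support[of _ t] by (metis envelope_inner)
    qed
    \<comment> \<open>A half turn shifts the argument by an odd multiple of pi, so the third
      harmonic is antiperiodic.\<close>
    have "sin (3 * (t + pi - \<phi>0)) = - sin (3 * (t - \<phi>0))" for t
      using sin_periodic_pi[of "3 * (t - \<phi>0)"] sin_periodic[of "3 * (t - \<phi>0) + pi"] by (simp add: algebra_simps)
    then have "?s t + ?s (t + pi) = 2 * d" for t
      by (simp add: steiner_support_def)
    then have "p t = ?s t" for t
      using le[of t] le[of "t + pi"] width[of t] by (smt (verit))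
    then show ?thesis
      by (intro Q_third_harmonic[OF osc.antiperiodic_C2_axioms]) (simp add: steiner_support_def)
  qed
qed

end

theorem theorem5p1:
  fixes K :: "(real ^ 2) set" and L F F\<^sub>e :: real
  assumes "compact K" and "convex K" and "K \<noteq> {}"
    and "strictly_convex_C2 K"
    and "constant_width K"
    and "L = boundary_length K"
    and "F = measure lebesgue K"
    and "F\<^sub>e = enveloped_area (evolute_support K)"
  shows "L\<^sup>2 - 4 * pi * F \<le> 4 / 9 * pi * \<bar>F\<^sub>e\<bar> \<and>
    (L\<^sup>2 - 4 * pi * F = 4 / 9 * pi * \<bar>F\<^sub>e\<bar> \<longleftrightarrow>
      is_circle (frontier K) \<or> parallel_to_steiner_curve (L / (2 * pi)) (frontier K))"
proof -
  obtain w where w: "\<And>t. support_fun K t + support_fun K (t + pi) = w"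
    using \<open>constant_width K\<close> by (auto simp: constant_width_def)
  interpret C2_constant_width K "w / 2"
    by unfold_locales (use assms w in auto)
  have deficit: "4 / 9 * pi * \<bar>F\<^sub>e\<bar> - (L\<^sup>2 - 4 * pi * F) = 4 / 9 * pi * osc.Q 0"
    using isoperimetric_deficit assms by simp
  then have "L\<^sup>2 - 4 * pi * F \<le> 4 / 9 * pi * \<bar>F\<^sub>e\<bar>"
    using mult_nonneg_nonneg[of "4 / 9 * pi" "osc.Q 0", OF _ osc.Q_nonneg] pi_gt_zero by linarith
  moreover have "L\<^sup>2 - 4 * pi * F = 4 / 9 * pi * \<bar>F\<^sub>e\<bar> \<longleftrightarrow> 4 / 9 * pi * osc.Q 0 = 0"
    unfolding deficit[symmetric] right_minus_eq by (rule eq_commute)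
  moreover have L: "L / (2 * pi) = w / 2"
    using boundary_length_width assms by simp
  ultimately show ?thesis
    unfolding L using Q_eq_0_iff by simp
qed

end
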